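(* Let $(L,\mathbb{F})$ be a Lévy process on $(\Omega,\mathscr{F},\mathbb{P};\mathbb{F})$ with finite horizon $T>0$, and assume that $L$ is not monotone, i.e. neither $L$ nor $-L$ is a subordinator. Let $\varphi_T(\kappa)=\mathbb{E}_{\mathbb{P}}[\exp(\kappa L_T)]\in(0,+\infty]$, $\kappa\in\mathbb{R}$, and let $\kappa_0$ be the unique point at which $\varphi_T$ attains its minimum. For $n\ge1$ let $\mathbb{P}_n$ be the approximating measure defined in the context and $\mathbb{P}_n^E$ the Esscher martingale measure for $(L,\mathbb{F})$ with respect to $\mathbb{P}_n$. Then $$\lim_{n\to\infty}I_T(\mathbb{P}^E_n,\mathbb{P})=\lim_{n\to\infty}I_T(\mathbb{P}^E_n,\mathbb{P}_n)=\inf_{\mathbb{Q}\in\tilde{\mathscr{M}}^{\rm loc}_a}I_T(\mathbb{Q},\mathbb{P})=-\log\varphi_T(\kappa_0).$$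
   Context: Time runs over $[0,T]$, $\mathbb{F}=(\mathscr{F}_t)_{t\in[0,T]}$, and $(L,\mathbb{F})$ is a real-valued Lévy process with respect to $\mathbb{F}$ under $\mathbb{P}$ (càdlàg, $L_0=0$, $\mathbb{F}$-adapted, stationary increments $L_t-L_s$ independent of $\mathscr{F}_s$) with Lévy measure $\nu$. Measures are considered on $\mathscr{F}_T$. Relative entropy of $\mathbb{Q}$ with respect to a probability measure $\mathbb{R}$: $I_T(\mathbb{Q},\mathbb{R})=\mathbb{E}_{\mathbb{R}}\big[\frac{d\mathbb{Q}}{d\mathbb{R}}|_{\mathscr{F}_T}\log\frac{d\mathbb{Q}}{d\mathbb{R}}|_{\mathscr{F}_T}\big]$ if $\mathbb{Q}|_{\mathscr{F}_T}\ll\mathbb{R}|_{\mathscr{F}_T}$, and $+\infty$ otherwise. $\tilde{\mathscr{M}}^{\rm loc}_a$ is the set of probability measures $\mathbb{Q}$ with $\mathbb{Q}|_{\mathscr{F}_T}\ll\mathbb{P}|_{\mathscr{F}_T}$ for which there is a sequence $(\tau_k)_{k\ge1}$ of $\mathbb{F}$-stopping times such that $\{\tau_k=T\}\uparrow\Omega$ as $k\to\infty$ and $\mathbb{E}_{\mathbb{Q}}[L_{\tau_k\wedge T}]=0$ (in particular this expectation exists) for all $k\ge1$. Approximating measures: for $n\ge1$ let $\rho_n(x)=x^2/n$ if $|x|>1$ and $\rho_n(x)=0$ otherwise, and $$Z^n_T=\exp\Big(-\sum_{0<u\le T}\rho_n(\Delta L_u)+T\int_{\mathbb{R}}(1-e^{-\rho_n(x)})\,\nu(dx)\Big),\qquad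 d\mathbb{P}_n=Z^n_T\,d\mathbb{P}.$$ Then $\mathbb{P}_n$ is a probability measure on $\mathscr{F}_T$ equivalent to $\mathbb{P}$, $(L,\mathbb{F})$ is a Lévy process under $\mathbb{P}_n$, and $L_T$ has finite exponential moments of all orders under $\mathbb{P}_n$. For a probability measure $\mathbb{R}$ and $\kappa\in\mathbb{R}$ (real number) with $\mathbb{E}_{\mathbb{R}}[e^{\kappa L_T}]<\infty$, the Esscher measure with respect to $\mathbb{R}$ has $\mathbb{R}$-density $e^{\kappa L_T}/\mathbb{E}_{\mathbb{R}}[e^{\kappa L_T}]$; it is the Esscher martingale measure (EMM) with respect to $\mathbb{R}$ if $(L,\mathbb{F})$ is a martingale under it. For non-monotone $L$ the EMM $\mathbb{P}_n^E$ with respect to $\mathbb{P}_n$ exists for every $n$. *)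

theory Defs
  imports "HOL-Probability.Probability"
begin

text \<open>Time runs over the interval \<open>[0, T]\<close>. The library indexes filtrations and stopping times by
  a whole type; a family \<open>F\<close>, of which only the members on \<open>[0, T]\<close> matter, is therefore extended
  constantly to the real line before these notions are applied to it.\<close>

definition extend_horizon :: "real \<Rightarrow> (real \<Rightarrow> 'a measure) \<Rightarrow> real \<Rightarrow> 'a measure" where
  "extend_horizon T F = (\<lambda>t. F (max 0 (min t T)))"

definition cadlag_on :: "real \<Rightarrow> (real \<Rightarrow> real) \<Rightarrow> bool" where
  "cadlag_on T f \<longleftrightarrow>
     (\<forall>t\<in>{0..<T}. continuous (at_right t) f) \<and>
     (\<forall>t\<in>{0<..T}. \<exists>l. (f \<longlongrightarrow> l) (at_left t))"

definition levy_process ::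
    "'a measure \<Rightarrow> (real \<Rightarrow> 'a measure) \<Rightarrow> real \<Rightarrow> (real \<Rightarrow> 'a \<Rightarrow> real) \<Rightarrow> bool" where
  "levy_process P F T L \<longleftrightarrow>
     (\<forall>t\<in>{0..T}. L t \<in> borel_measurable (F t)) \<and>
     (\<forall>\<omega>\<in>space P. L 0 \<omega> = 0) \<and>
     (\<forall>\<omega>\<in>space P. cadlag_on T (\<lambda>t. L t \<omega>)) \<and>
     (\<forall>s t h. 0 \<le> s \<and> 0 \<le> t \<and> 0 \<le> h \<and> s + h \<le> T \<and> t + h \<le> T \<longrightarrow>
        distr P borel (\<lambda>\<omega>. L (s + h) \<omega> - L s \<omega>) = distr P borel (\<lambda>\<omega>. L (t + h) \<omega> - L t \<omega>)) \<and>
     (\<forall>s t. 0 \<le> s \<and> s \<le> t \<and> t \<le> T \<longrightarrow>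
        prob_space.indep_set P
          (sets (vimage_algebra (space P) (\<lambda>\<omega>. L t \<omega> - L s \<omega>) borel)) (sets (F s)))"

definition subordinator ::
    "'a measure \<Rightarrow> (real \<Rightarrow> 'a measure) \<Rightarrow> real \<Rightarrow> (real \<Rightarrow> 'a \<Rightarrow> real) \<Rightarrow> bool" where
  "subordinator P F T L \<longleftrightarrow>
     levy_process P F T L \<and> (AE \<omega> in P. mono_on {0..T} (\<lambda>t. L t \<omega>))"

definition jump :: "(real \<Rightarrow> 'a \<Rightarrow> real) \<Rightarrow> real \<Rightarrow> 'a \<Rightarrow> real" where
  "jump L u \<omega> = L u \<omega> - Lim (at_left u) (\<lambda>s. L s \<omega>)"

text \<open>The Levy measure of a set \<open>A\<close> is the expected number, per unit of time, of nonzero jumps with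
  size in \<open>A\<close>; by stationarity it can be computed on the whole horizon.\<close>

definition is_levy_measure ::
    "'a measure \<Rightarrow> real \<Rightarrow> (real \<Rightarrow> 'a \<Rightarrow> real) \<Rightarrow> real measure \<Rightarrow> bool" where
  "is_levy_measure P T L \<nu> \<longleftrightarrow>
     sets \<nu> = sets borel \<and>
     (\<forall>A\<in>sets borel. emeasure \<nu> A =
        (\<integral>\<^sup>+\<omega>. emeasure (count_space UNIV) {u\<in>{0<..T}. jump L u \<omega> \<noteq> 0 \<and> jump L u \<omega> \<in> A} \<partial>P)
          / ennreal T)"

definition martingale_on ::
    "'a measure \<Rightarrow> (real \<Rightarrow> 'a measure) \<Rightarrow> real \<Rightarrow> (real \<Rightarrow> 'a \<Rightarrow> real) \<Rightarrow> bool" where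
  "martingale_on Q F T L \<longleftrightarrow>
     (\<forall>t\<in>{0..T}. L t \<in> borel_measurable (F t) \<and> integrable Q (L t)) \<and>
     (\<forall>s t. 0 \<le> s \<and> s \<le> t \<and> t \<le> T \<longrightarrow>
        (AE \<omega> in Q. real_cond_exp Q (F s) (L t) \<omega> = L s \<omega>))"

text \<open>Relative entropy on the sub-\<open>\<sigma>\<close>-algebra \<open>G\<close>. The function \<open>x ln x\<close> (which is \<open>0\<close> at \<open>0\<close>) is
  bounded below, so for a probability measure \<open>R\<close> its composition with the density is either
  integrable or has integral \<open>\<infinity>\<close>.\<close>

definition rel_entropy :: "'a measure \<Rightarrow> 'a measure \<Rightarrow> 'a measure \<Rightarrow> ereal" where
  "rel_entropy G Q R =
     (let Q' = restr_to_subalg Q G;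
          R' = restr_to_subalg R G;
          Z = (\<lambda>\<omega>. enn2real (RN_deriv R' Q' \<omega>))
      in if absolutely_continuous R' Q' \<and> integrable R' (\<lambda>\<omega>. Z \<omega> * ln (Z \<omega>))
         then ereal (\<integral>\<omega>. Z \<omega> * ln (Z \<omega>) \<partial>R')
         else \<infinity>)"

text \<open>The stopping times \<open>\<tau> k\<close> may take values above \<open>T\<close>, which stand for \<open>\<infinity>\<close>.\<close>

definition M_loc_a ::
    "'a measure \<Rightarrow> (real \<Rightarrow> 'a measure) \<Rightarrow> real \<Rightarrow> (real \<Rightarrow> 'a \<Rightarrow> real) \<Rightarrow> 'a measure set" where
  "M_loc_a P F T L =
     {Q. prob_space Q \<and> space Q = space P \<and> sets Q = sets (F T) \<and>
         absolutely_continuous (restr_to_subalg P (F T)) Q \<and>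
         (\<exists>\<tau> :: nat \<Rightarrow> 'a \<Rightarrow> real.
            (\<forall>k. stopping_time (extend_horizon T F) (\<tau> k) \<and> (\<forall>\<omega>\<in>space P. 0 \<le> \<tau> k \<omega>)) \<and>
            incseq (\<lambda>k. {\<omega>\<in>space P. \<tau> k \<omega> = T}) \<and>
            (\<Union>k. {\<omega>\<in>space P. \<tau> k \<omega> = T}) = space P \<and>
            (\<forall>k. integrable Q (\<lambda>\<omega>. L (min (\<tau> k \<omega>) T) \<omega>) \<and>
                 (\<integral>\<omega>. L (min (\<tau> k \<omega>) T) \<omega> \<partial>Q) = 0))}"

definition rho :: "nat \<Rightarrow> real \<Rightarrow> real" where
  "rho n x = (if \<bar>x\<bar> > 1 then x\<^sup>2 / real n else 0)"

definition Z_approx :: "real \<Rightarrow> (real \<Rightarrow> 'a \<Rightarrow> real) \<Rightarrow> real measure \<Rightarrow> nat \<Rightarrow> 'a \<Rightarrow> real" where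
  "Z_approx T L \<nu> n \<omega> =
     exp (- (\<Sum>\<^sub>\<infinity>u\<in>{0<..T}. rho n (jump L u \<omega>)) + T * (\<integral>x. (1 - exp (- rho n x)) \<partial>\<nu>))"

definition P_approx ::
    "'a measure \<Rightarrow> (real \<Rightarrow> 'a measure) \<Rightarrow> real \<Rightarrow> (real \<Rightarrow> 'a \<Rightarrow> real) \<Rightarrow> real measure \<Rightarrow> nat
      \<Rightarrow> 'a measure" where
  "P_approx P F T L \<nu> n =
     density (restr_to_subalg P (F T)) (\<lambda>\<omega>. ennreal (Z_approx T L \<nu> n \<omega>))"

definition esscher :: "'a measure \<Rightarrow> real \<Rightarrow> (real \<Rightarrow> 'a \<Rightarrow> real) \<Rightarrow> real \<Rightarrow> 'a measure" where
  "esscher R T L \<kappa> =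
     density R (\<lambda>\<omega>. ennreal (exp (\<kappa> * L T \<omega>) / (\<integral>\<omega>'. exp (\<kappa> * L T \<omega>') \<partial>R)))"

definition is_EMM ::
    "'a measure \<Rightarrow> (real \<Rightarrow> 'a measure) \<Rightarrow> real \<Rightarrow> (real \<Rightarrow> 'a \<Rightarrow> real) \<Rightarrow> 'a measure \<Rightarrow> bool" where
  "is_EMM R F T L Q \<longleftrightarrow>
     (\<exists>\<kappa>. integrable R (\<lambda>\<omega>. exp (\<kappa> * L T \<omega>)) \<and> Q = esscher R T L \<kappa>) \<and>
     martingale_on Q F T L"

definition mgf :: "'a measure \<Rightarrow> real \<Rightarrow> (real \<Rightarrow> 'a \<Rightarrow> real) \<Rightarrow> real \<Rightarrow> ennreal" where
  "mgf P T L \<kappa> = (\<integral>\<^sup>+\<omega>. ennreal (exp (\<kappa> * L T \<omega>)) \<partial>P)"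

end

theory Submission
  imports Defs
begin
text \<open>
  Write \<open>X = L T\<close>, let \<open>S\<close> be the sum of the squares of the jumps of absolute value
  larger than one, and let
  \<open>\<phi>\<close> be the moment generating function of \<open>X\<close>.  The density of the \<open>n\<close>-th approximating measure is
  \<open>exp (T c\<^sub>n) exp (- S / n)\<close> with the deterministic compensator
  \<open>c\<^sub>n = \<integral> (1 - exp (- \<rho>\<^sub>n)) d\<nu>\<close>.  The deterministic factor cancels in the Esscher transform, so the EMM has
  \<open>P\<close>-density \<open>exp (\<kappa>\<^sub>n X - S / n) / m\<^sub>n\<close>, where \<open>m\<^sub>n = E exp (\<kappa>\<^sub>n X - S / n)\<close>.

  The martingale property gives \<open>X\<close> mean zero under the EMM.  By \<open>exp y \<ge> 1 + y\<close> this means that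
  \<open>\<kappa>\<^sub>n\<close> minimises \<open>\<kappa> \<mapsto> E exp (\<kappa> X - S / n)\<close>, so \<open>m\<^sub>n\<close> is the minimum of this damped moment
  generating function (lemma \<open>martingale_tilt_minimises\<close>).  These functions increase to \<open>\<phi>\<close>.  As \<open>L\<close> is
  not monotone, \<open>X\<close> takes both signs with positive probability, which keeps the minimisers bounded, and
  Fatou's lemma gives \<open>m\<^sub>n \<longlonglongrightarrow> min \<phi> = \<phi> \<kappa>\<^sub>0\<close> (lemma
  \<open>damped_mgf_minimum_tendsto\<close>).

  The entropies can now be read off.  With respect to the approximating measure the entropy of the EMM is
  \<open>- T c\<^sub>n - ln m\<^sub>n\<close>, and \<open>c\<^sub>n \<longlonglongrightarrow> 0\<close> because \<open>\<nu>\<close> is finite on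
  \<open>{\<bar>x\<bar> > 1}\<close>.  With respect to \<open>P\<close> it is at most \<open>- ln m\<^sub>n\<close> because \<open>S \<ge> 0\<close>.
  Conversely, every \<open>Q\<close> in the class of local martingale measures has entropy at least \<open>- ln (\<phi> \<kappa>\<^sub>0)\<close>
  (lemma \<open>entropy_lower_bound_M_loc_a\<close>): for a localising time \<open>\<tau>\<close> the Gibbs variational inequality gives
  the bound \<open>- ln E exp (\<kappa>\<^sub>0 L\<^sub>\<tau>)\<close>, and \<open>E exp (\<kappa>\<^sub>0 L\<^sub>\<tau>)\<close> exceeds \<open>\<phi> \<kappa>\<^sub>0\<close> by at most
  \<open>E (exp (\<kappa>\<^sub>0 X); \<tau> < T) / \<phi> \<kappa>\<^sub>0\<close>, which vanishes along the localising sequence.  Since each EMM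
  belongs to the class, all three quantities have the same value.

  The properties of \<open>L\<close> behind these steps are derived from its increments over the grids
  \<open>{i T / m | i. i \<le> m}\<close>, which are identically distributed and independent of
  the past.  Cadlag paths transfer the
  statements on grids to continuous time: grid sums of a function of the increments converge to the
  corresponding sums over the jumps, which makes \<open>S\<close> measurable and bounds the expected number of large
  jumps, and a stopping time is the limit from the right of the next grid point.
\<close>

section \<open>Cadlag paths on equidistant grids\<close>

text \<open>A cadlag path is nearly constant between finitely many times: near each \<open>x\<close> one exceptional time,
  \<open>x\<close> itself, suffices by the one-sided limits, and the property is inherited by the union of two adjacent
  intervals, so that bisection applies.\<close>
lemma cadlag_partition:
  fixes f :: "real \<Rightarrow> real"
  assumes f: "cadlag_on T f" and T: "0 < T" and e: "0 < e"
  shows "\<exists>C. finite C \<and> (\<forall>s t. 0 \<le> s \<and> s \<le> t \<and> t \<le> T \<and> C \<inter> {s<..t} = {} \<longrightarrow> \<bar>f t - f s\<bar> < e)"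
proof -
  define good where "good a b \<longleftrightarrow> (\<exists>C. finite C \<and>
    (\<forall>s t. 0 \<le> s \<and> s \<le> t \<and> t \<le> T \<and> a \<le> s \<and> t \<le> b \<and> C \<inter> {s<..t} = {} \<longrightarrow> \<bar>f t - f s\<bar> < e))"
    for a b
  have "good 0 T"
  proof (rule Bolzano)
    show "0 \<le> T" using T by simp
  next
    fix a b c assume "good a b" "good b c" "a \<le> b" "b \<le> c"
    then obtain C D where C: "finite C" "\<And>s t. 0 \<le> s \<and> s \<le> t \<and> t \<le> T \<and> a \<le> s \<and> t \<le> b \<and> C \<inter> {s<..t} = {} \<Longrightarrow> \<bar>f t - f s\<bar> < e"
      and D: "finite D" "\<And>s t. 0 \<le> s \<and> s \<le> t \<and> t \<le> T \<and> b \<le> s \<and> t \<le> c \<and> D \<inter> {s<..t} = {} \<Longrightarrow> \<bar>f t - f s\<bar> < e"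
      unfolding good_def by meson
    show "good a c" unfolding good_def
    proof (intro exI[of _ "insert b (C \<union> D)"] conjI allI impI)
      fix s t
      assume st: "0 \<le> s \<and> s \<le> t \<and> t \<le> T \<and> a \<le> s \<and> t \<le> c \<and> insert b (C \<union> D) \<inter> {s<..t} = {}"
      then have "t < b \<or> b \<le> s" by (auto simp: not_le)
      then show "\<bar>f t - f s\<bar> < e"
        using C(2)[of s t] D(2)[of s t] st by (smt (verit, best) Int_Un_distrib2 Int_insert_left_if0 Un_empty insert_not_empty Int_insert_left)
    qed (use C D in auto)
  next
    fix x :: real assume x: "0 \<le> x" "x \<le> T"
    have r: "\<exists>d>0. \<forall>t. x \<le> t \<and> t < x + d \<and> t \<le> T \<longrightarrow> \<bar>f t - f x\<bar> < e / 2"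
    proof (cases "x < T")
      case True
      then have "(f \<longlongrightarrow> f x) (at_right x)" using f x by (auto simp: cadlag_on_def continuous_within)
      then have "eventually (\<lambda>t. dist (f t) (f x) < e / 2) (at_right x)" using e by (intro tendstoD) auto
      then obtain b where "b > x" "\<And>t. x < t \<Longrightarrow> t < b \<Longrightarrow> \<bar>f t - f x\<bar> < e / 2"
        by (auto simp: eventually_at_right_field dist_real_def)
      then show ?thesis using e by (intro exI[of _ "b - x"]) (auto simp: le_less)
    next
      case False
      then show ?thesis using x e by (intro exI[of _ 1]) auto
    qed
    have l: "\<exists>d>0. \<exists>l. \<forall>t. 0 \<le> t \<and> x - d < t \<and> t < x \<longrightarrow> \<bar>f t - l\<bar> < e / 2"
    proof (cases "0 < x")
      case True
      then obtain l where "(f \<longlongrightarrow> l) (at_left x)" using f x by (force simp: cadlag_on_def)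
      then have "eventually (\<lambda>t. dist (f t) l < e / 2) (at_left x)" using e by (intro tendstoD) auto
      then obtain b where "b < x" "\<And>t. b < t \<Longrightarrow> t < x \<Longrightarrow> \<bar>f t - l\<bar> < e / 2"
        by (auto simp: eventually_at_left_field dist_real_def)
      then show ?thesis by (intro exI[of _ "x - b"]) auto
    next
      case False
      then show ?thesis using x by (intro exI[of _ 1]) auto
    qed
    obtain d1 where d1: "d1 > 0" "\<And>t. x \<le> t \<Longrightarrow> t < x + d1 \<Longrightarrow> t \<le> T \<Longrightarrow> \<bar>f t - f x\<bar> < e / 2" using r by auto
    obtain d2 l where d2: "d2 > 0" "\<And>t. 0 \<le> t \<Longrightarrow> x - d2 < t \<Longrightarrow> t < x \<Longrightarrow> \<bar>f t - l\<bar> < e / 2" using l by auto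
    show "\<exists>d>0. \<forall>a b. a \<le> x \<and> x \<le> b \<and> b - a < d \<longrightarrow> good a b"
    proof (intro exI[of _ "min d1 d2"] conjI allI impI)
      fix a b assume ab: "a \<le> x \<and> x \<le> b \<and> b - a < min d1 d2"
      show "good a b" unfolding good_def
      proof (intro exI[of _ "{x}"] conjI allI impI)
        fix s t assume st: "0 \<le> s \<and> s \<le> t \<and> t \<le> T \<and> a \<le> s \<and> t \<le> b \<and> {x} \<inter> {s<..t} = {}"
        then have "t < x \<or> x \<le> s" by (auto simp: not_le)
        then show "\<bar>f t - f s\<bar> < e"
        proof
          assume "t < x"
          then have "\<bar>f s - l\<bar> < e / 2" "\<bar>f t - l\<bar> < e / 2" using d2(2)[of s] d2(2)[of t] st ab by auto
          then show ?thesis by linarith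
        next
          assume "x \<le> s"
          then have "\<bar>f s - f x\<bar> < e / 2" "\<bar>f t - f x\<bar> < e / 2" using d1(2)[of s] d1(2)[of t] st ab by auto
          then show ?thesis by linarith
        qed
      qed simp
    qed (use d1 d2 in auto)
  qed
  then show ?thesis unfolding good_def by force
qed

definition grid :: "real \<Rightarrow> nat \<Rightarrow> nat \<Rightarrow> real" where
  "grid T m i = T * real i / real m"

lemma grid_0 [simp]: "grid T m 0 = 0" by (simp add: grid_def)

lemma grid_m [simp]: "0 < m \<Longrightarrow> grid T m m = T" by (simp add: grid_def)

lemma grid_Suc: "grid T m (Suc i) = grid T m i + T / real m"
  by (simp add: grid_def field_simps add_divide_distrib)

lemma grid_nonneg [simp]: "0 \<le> T \<Longrightarrow> 0 \<le> grid T m i" by (simp add: grid_def)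

lemma grid_le_horizon: "0 \<le> T \<Longrightarrow> i \<le> m \<Longrightarrow> grid T m i \<le> T"
  by (cases "m = 0") (auto simp: grid_def field_simps mult_left_mono)

lemma grid_mono: "0 \<le> T \<Longrightarrow> i \<le> j \<Longrightarrow> grid T m i \<le> grid T m j"
  by (simp add: grid_def divide_right_mono mult_left_mono)

text \<open>The cells of the \<open>m\<close>-th grid are half-open, \<open>{grid T m i<..grid T m (Suc i)}\<close>, so that a jump
  at \<open>u\<close> falls into the increment over the cell that contains \<open>u\<close>.\<close>
definition cell :: "real \<Rightarrow> nat \<Rightarrow> real \<Rightarrow> nat" where
  "cell T m u = nat \<lceil>u * real m / T\<rceil> - 1"

lemma cell_bounds:
  assumes "0 < T" "0 < m" "u \<in> {0<..T}"
  shows "cell T m u < m" "grid T m (cell T m u) < u" "u \<le> grid T m (Suc (cell T m u))"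
proof -
  let ?k = "\<lceil>u * real m / T\<rceil>"
  have p: "0 < u * real m / T" using assms by simp
  have k0: "1 \<le> ?k" using p by linarith
  have "u * real m / T \<le> real m" using assms by (simp add: field_simps)
  then have km: "?k \<le> int m" by (simp add: ceiling_le_iff)
  have sc: "real (Suc (cell T m u)) = real_of_int ?k" using k0 by (simp add: cell_def of_nat_diff)
  have c: "real (cell T m u) = real_of_int ?k - 1" using sc by simp
  show "cell T m u < m" using k0 km by (simp add: cell_def) linarith
  have "real_of_int ?k - 1 < u * real m / T" by linarith
  then show "grid T m (cell T m u) < u" unfolding grid_def c using assms by (simp add: field_simps)
  have "u * real m \<le> T * real_of_int ?k" using assms le_of_int_ceiling[of "u * real m / T"]
    by (subst (asm) divide_le_eq) (simp add: mult.commute)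
  then show "u \<le> grid T m (Suc (cell T m u))" unfolding grid_def sc using assms by (simp add: le_divide_eq)
qed

lemma cell_eqI:
  assumes T: "0 < T" and m: "0 < m" and u: "u \<in> {grid T m i<..grid T m (Suc i)}"
  shows "cell T m u = i"
proof -
  have "real i < u * real m / T" "u * real m / T \<le> real i + 1"
    using assms by (auto simp: grid_def field_simps)
  then have "\<lceil>u * real m / T\<rceil> = int i + 1" by (intro ceiling_unique) auto
  then show ?thesis by (simp add: cell_def nat_add_distrib)
qed

lemma grid_cell_tendsto:
  assumes T: "0 < T" and u: "u \<in> {0<..T}"
  shows "filterlim (\<lambda>m. grid T m (cell T m u)) (at_left u) sequentially"
    and "(\<lambda>m. grid T m (Suc (cell T m u))) \<longlonglongrightarrow> u"
proof -
  have mesh: "(\<lambda>m. T / real m) \<longlonglongrightarrow> 0" by (rule lim_const_over_n)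
  have ev: "eventually (\<lambda>m. u - T / real m \<le> grid T m (cell T m u) \<and> grid T m (cell T m u) < u
      \<and> u \<le> grid T m (Suc (cell T m u)) \<and> grid T m (Suc (cell T m u)) \<le> u + T / real m) sequentially"
    using eventually_gt_at_top[of 0]
  proof eventually_elim
    case (elim m)
    show ?case using cell_bounds[OF T elim u] grid_Suc[of T m "cell T m u"] by auto
  qed
  have l: "(\<lambda>m. u - T / real m) \<longlonglongrightarrow> u" using tendsto_diff[OF tendsto_const mesh, of u] by simp
  have r: "(\<lambda>m. u + T / real m) \<longlonglongrightarrow> u" using tendsto_add[OF tendsto_const mesh, of u] by simp
  have "(\<lambda>m. grid T m (cell T m u)) \<longlonglongrightarrow> u"
    by (rule tendsto_sandwich[OF _ _ l tendsto_const]) (use ev in \<open>auto elim: eventually_mono\<close>)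
  then show "filterlim (\<lambda>m. grid T m (cell T m u)) (at_left u) sequentially"
    by (auto simp: filterlim_at intro: eventually_mono[OF ev])
  show "(\<lambda>m. grid T m (Suc (cell T m u))) \<longlonglongrightarrow> u"
    by (rule tendsto_sandwich[OF _ _ tendsto_const r]) (use ev in \<open>auto elim: eventually_mono\<close>)
qed

lemma cadlag_left_limit:
  assumes "cadlag_on T (\<lambda>t. L t \<omega>)" "u \<in> {0<..T}"
  shows "((\<lambda>s. L s \<omega>) \<longlongrightarrow> L u \<omega> - jump L u \<omega>) (at_left u)"
proof -
  obtain l where "((\<lambda>s. L s \<omega>) \<longlongrightarrow> l) (at_left u)" using assms by (meson cadlag_on_def)
  then show ?thesis by (simp add: jump_def tendsto_Lim)
qed

lemma cadlag_tendsto_from_right: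
  assumes f: "cadlag_on T f" and u: "0 \<le> u" "u < T"
    and x: "x \<longlonglongrightarrow> u" "eventually (\<lambda>m. u \<le> x m) sequentially"
  shows "(\<lambda>m. f (x m)) \<longlonglongrightarrow> f u"
proof (rule tendstoI)
  fix e :: real assume e: "0 < e"
  have "(f \<longlongrightarrow> f u) (at_right u)" using f u by (auto simp: cadlag_on_def continuous_within)
  then have "eventually (\<lambda>t. dist (f t) (f u) < e) (at_right u)" using e by (intro tendstoD) auto
  then obtain b where b: "b > u" "\<And>t. u < t \<Longrightarrow> t < b \<Longrightarrow> dist (f t) (f u) < e"
    by (auto simp: eventually_at_right_field)
  show "eventually (\<lambda>m. dist (f (x m)) (f u) < e) sequentially"
    using order_tendstoD(2)[OF x(1) b(1)] x(2)
    by eventually_elim (use b(2) e in \<open>auto simp: le_less\<close>)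
qed

text \<open>Index of the first grid point that is not before \<open>u\<close>.  It agrees with \<open>Suc (cell T m u)\<close> for
  \<open>u > 0\<close> but is \<open>0\<close> at \<open>u = 0\<close>.\<close>
definition next_ix :: "real \<Rightarrow> nat \<Rightarrow> real \<Rightarrow> nat" where
  "next_ix T m u = nat \<lceil>u * real m / T\<rceil>"

lemma next_ix_pos: "0 < T \<Longrightarrow> 0 < m \<Longrightarrow> 0 < u \<Longrightarrow> next_ix T m u = Suc (cell T m u)"
proof -
  assume "0 < T" "0 < m" "0 < u"
  then have "0 < u * real m / T" by simp
  then have "0 < \<lceil>u * real m / T\<rceil>" by linarith
  then show ?thesis by (simp add: next_ix_def cell_def)
qed

lemma next_ix_0 [simp]: "next_ix T m 0 = 0" by (simp add: next_ix_def)

lemma next_ix_le: "0 < T \<Longrightarrow> 0 < m \<Longrightarrow> u \<in> {0..T} \<Longrightarrow> next_ix T m u \<le> m"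
  using cell_bounds(1)[of T m u] next_ix_pos[of T m u] by (cases "u = 0") auto

lemma next_ix_mono: "0 < T \<Longrightarrow> u \<le> v \<Longrightarrow> next_ix T m u \<le> next_ix T m v"
  unfolding next_ix_def by (intro nat_mono ceiling_mono divide_right_mono mult_right_mono) auto

lemma next_ix_le_iff:
  assumes "0 < T" "0 < m"
  shows "next_ix T m u \<le> i \<longleftrightarrow> u \<le> grid T m i"
proof -
  have "next_ix T m u \<le> i \<longleftrightarrow> u * real m / T \<le> real i"
    by (simp add: next_ix_def nat_le_iff ceiling_le_iff)
  then show ?thesis using assms by (simp add: grid_def field_simps)
qed

lemma cadlag_grid_tendsto:
  assumes f: "cadlag_on T f" and T: "0 < T" and u: "u \<in> {0..T}"
  shows "(\<lambda>m. f (grid T m (next_ix T m u))) \<longlonglongrightarrow> f u"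
proof (cases "u = 0")
  case False
  then have u': "u \<in> {0<..T}" using u by auto
  have ev: "eventually (\<lambda>m. next_ix T m u = Suc (cell T m u)) sequentially"
    using eventually_gt_at_top[of 0] by eventually_elim (use T u' next_ix_pos in auto)
  have "(\<lambda>m. f (grid T m (Suc (cell T m u)))) \<longlonglongrightarrow> f u"
  proof (cases "u < T")
    case True
    show ?thesis
      by (rule cadlag_tendsto_from_right[OF f _ True grid_cell_tendsto(2)[OF T u']])
         (use u' cell_bounds(3)[OF T _ u'] in \<open>auto intro: eventually_mono[OF eventually_gt_at_top[of 0]]\<close>)
  next
    case False
    then have uT: "u = T" using u by auto
    have "eventually (\<lambda>m. grid T m (Suc (cell T m u)) = u) sequentially"
      using eventually_gt_at_top[of 0]
    proof eventually_elim
      case (elim m)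
      then show ?case using cell_bounds[OF T elim u'] grid_le_horizon[of T "Suc (cell T m u)" m] uT T by auto
    qed
    then show ?thesis by (intro tendsto_eventually) (auto elim: eventually_mono)
  qed
  then show ?thesis by (rule Lim_transform_eventually) (use ev in \<open>auto elim: eventually_mono\<close>)
qed simp

lemma cell_increment_tendsto_jump:
  assumes L: "cadlag_on T (\<lambda>t. L t \<omega>)" and T: "0 < T" and u: "u \<in> {0<..T}"
  shows "(\<lambda>m. L (grid T m (Suc (cell T m u))) \<omega> - L (grid T m (cell T m u)) \<omega>) \<longlonglongrightarrow> jump L u \<omega>"
proof -
  have l: "(\<lambda>m. L (grid T m (cell T m u)) \<omega>) \<longlonglongrightarrow> L u \<omega> - jump L u \<omega>"
    by (rule filterlim_compose[OF cadlag_left_limit[of T L \<omega> u] grid_cell_tendsto(1)[OF T u]]) (use L u in auto)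
  have r: "(\<lambda>m. L (grid T m (Suc (cell T m u))) \<omega>) \<longlonglongrightarrow> L u \<omega>"
  proof (rule Lim_transform_eventually)
    show "(\<lambda>m. L (grid T m (next_ix T m u)) \<omega>) \<longlonglongrightarrow> L u \<omega>"
      by (rule cadlag_grid_tendsto[OF L T]) (use u in auto)
    show "eventually (\<lambda>m. L (grid T m (next_ix T m u)) \<omega> = L (grid T m (Suc (cell T m u))) \<omega>) sequentially"
      using eventually_gt_at_top[of 0] by eventually_elim (use T u next_ix_pos in auto)
  qed
  show ?thesis using tendsto_diff[OF r l] by simp
qed

lemma small_jump_off_partition:
  assumes L: "cadlag_on T (\<lambda>t. L t \<omega>)" and C: "finite C"
    "\<forall>s t. 0 \<le> s \<and> s \<le> t \<and> t \<le> T \<and> C \<inter> {s<..t} = {} \<longrightarrow> \<bar>L t \<omega> - L s \<omega>\<bar> < e"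
    and u: "u \<in> {0<..T} - C"
  shows "\<bar>jump L u \<omega>\<bar> \<le> e"
proof -
  have "((\<lambda>s. L s \<omega>) \<longlongrightarrow> L u \<omega> - jump L u \<omega>) (at_left u)"
    by (rule cadlag_left_limit[of T]) (use L u in auto)
  from tendsto_rabs[OF tendsto_diff[OF tendsto_const this, of "L u \<omega>"]]
  have lim: "((\<lambda>s. \<bar>L u \<omega> - L s \<omega>\<bar>) \<longlongrightarrow> \<bar>jump L u \<omega>\<bar>) (at_left u)" by simp
  have "eventually (\<lambda>s. \<forall>c\<in>C. c \<le> s \<or> u < c) (at_left u)"
  proof (subst eventually_ball_finite_distrib[OF C(1)], intro ballI)
    fix c assume "c \<in> C"
    then have "c < u \<or> u < c" using u by (metis DiffD2 linorder_neqE)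
    then show "eventually (\<lambda>s. c \<le> s \<or> u < c) (at_left u)"
    proof
      assume "c < u"
      then show ?thesis by (intro eventually_at_leftI[of c]) auto
    qed simp
  qed
  moreover have "eventually (\<lambda>s. 0 \<le> s \<and> s < u) (at_left u)"
    using u by (intro eventually_at_leftI[of 0]) auto
  ultimately have "eventually (\<lambda>s. \<bar>L u \<omega> - L s \<omega>\<bar> \<le> e) (at_left u)"
  proof eventually_elim
    case (elim s)
    then have "C \<inter> {s<..u} = {}" using u by (auto simp: not_le[symmetric])
    then show ?case using C(2)[rule_format, of s u] elim u by auto
  qed
  from tendsto_upperbound[OF lim this] show ?thesis by (simp add: trivial_limit_at_left_real)
qed

lemma finite_large_jumps:
  assumes "cadlag_on T (\<lambda>t. L t \<omega>)" "0 < T"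
  shows "finite {u\<in>{0<..T}. 1 < \<bar>jump L u \<omega>\<bar>}"
proof -
  obtain C where C: "finite C" "\<forall>s t. 0 \<le> s \<and> s \<le> t \<and> t \<le> T \<and> C \<inter> {s<..t} = {} \<longrightarrow> \<bar>L t \<omega> - L s \<omega>\<bar> < 1"
    using cadlag_partition[OF assms zero_less_one] by blast
  have "{u\<in>{0<..T}. 1 < \<bar>jump L u \<omega>\<bar>} \<subseteq> C"
    using small_jump_off_partition[of T L \<omega> C 1, OF assms(1) C] by (auto simp: not_le[symmetric])
  then show ?thesis using C(1) finite_subset by blast
qed

lemma infsum_jumps:
  fixes g :: "real \<Rightarrow> real"
  assumes "cadlag_on T (\<lambda>t. L t \<omega>)" "0 < T" and g: "\<And>x. \<bar>x\<bar> \<le> 1 \<Longrightarrow> g x = 0"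
    and C: "finite C" "C \<subseteq> {0<..T}" "{u\<in>{0<..T}. 1 < \<bar>jump L u \<omega>\<bar>} \<subseteq> C"
  shows "(\<Sum>\<^sub>\<infinity>u\<in>{0<..T}. g (jump L u \<omega>)) = (\<Sum>u\<in>C. g (jump L u \<omega>))"
proof -
  have "(\<Sum>\<^sub>\<infinity>u\<in>{0<..T}. g (jump L u \<omega>)) = (\<Sum>\<^sub>\<infinity>u\<in>C. g (jump L u \<omega>))"
    by (rule infsum_cong_neutral) (use C g in \<open>auto simp: not_less[symmetric]\<close>)
  then show ?thesis using C(1) by simp
qed

text \<open>Take the finite partition for oscillation \<open>1\<close>.  An increment over a cell that misses it is smaller
  than \<open>1\<close> and contributes nothing.  On fine grids the points of the partition lie in different cells,
  and the increments over these cells tend to the jumps there.\<close>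
lemma grid_sum_tendsto_jump_sum:
  fixes g :: "real \<Rightarrow> real"
  assumes L: "cadlag_on T (\<lambda>t. L t \<omega>)" and T: "0 < T"
    and g: "continuous_on UNIV g" "\<And>x. \<bar>x\<bar> \<le> 1 \<Longrightarrow> g x = 0"
  shows "(\<lambda>m. \<Sum>i<m. g (L (grid T m (Suc i)) \<omega> - L (grid T m i) \<omega>))
           \<longlonglongrightarrow> (\<Sum>\<^sub>\<infinity>u\<in>{0<..T}. g (jump L u \<omega>))"
proof -
  obtain C' where C': "finite C'" "\<forall>s t. 0 \<le> s \<and> s \<le> t \<and> t \<le> T \<and> C' \<inter> {s<..t} = {} \<longrightarrow> \<bar>L t \<omega> - L s \<omega>\<bar> < 1"
    using cadlag_partition[OF L T zero_less_one] by blast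
  define C where "C = C' \<inter> {0<..T}"
  have C: "finite C" "C \<subseteq> {0<..T}" using C' by (auto simp: C_def)
  have big: "{u\<in>{0<..T}. 1 < \<bar>jump L u \<omega>\<bar>} \<subseteq> C"
    using small_jump_off_partition[of T L \<omega> C' 1, OF L C'] by (auto simp: C_def not_le[symmetric])
  let ?I = "\<lambda>m i. L (grid T m (Suc i)) \<omega> - L (grid T m i) \<omega>"
  have inj: "eventually (\<lambda>m. inj_on (cell T m) C) sequentially"
  proof -
    have "eventually (\<lambda>m. \<forall>u\<in>C. \<forall>v\<in>C. u < v \<longrightarrow> T / real m < v - u) sequentially"
    proof (intro eventually_ball_finite C ballI)
      fix u v
      have "eventually (\<lambda>m. T / real m < v - u) sequentially" if "u < v"
        using order_tendstoD(2)[OF lim_const_over_n[of T], of "v - u"] that by simp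
      then show "eventually (\<lambda>m. u < v \<longrightarrow> T / real m < v - u) sequentially" by (cases "u < v") auto
    qed
    then show ?thesis using eventually_gt_at_top[of 0]
    proof eventually_elim
      case (elim m)
      show ?case
      proof (rule linorder_inj_onI)
        fix u v assume uv: "u < v" "u \<in> C" "v \<in> C"
        then have "T / real m < v - u" using elim by auto
        moreover have "grid T m (cell T m u) < u" "v \<le> grid T m (Suc (cell T m v))"
          using cell_bounds[of T m] T elim C uv by auto
        ultimately show "cell T m u \<noteq> cell T m v" using grid_Suc[of T m "cell T m u"] by auto
      qed auto
    qed
  qed
  have "eventually (\<lambda>m. (\<Sum>u\<in>C. g (?I m (cell T m u))) = (\<Sum>i<m. g (?I m i))) sequentially"
    using inj eventually_gt_at_top[of 0]
  proof eventually_elim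
    case (elim m)
    have "(\<Sum>u\<in>C. g (?I m (cell T m u))) = (\<Sum>i\<in>cell T m ` C. g (?I m i))"
      by (simp add: sum.reindex[OF elim(1)])
    also have "\<dots> = (\<Sum>i<m. g (?I m i))"
    proof (rule sum.mono_neutral_left)
      show "cell T m ` C \<subseteq> {..<m}" using cell_bounds(1)[OF T elim(2)] C by auto
      show "\<forall>i\<in>{..<m} - cell T m ` C. g (?I m i) = 0"
      proof
        fix i assume i: "i \<in> {..<m} - cell T m ` C"
        then have iT: "grid T m (Suc i) \<le> T" using grid_le_horizon[of T "Suc i" m] T by auto
        have "C' \<inter> {grid T m i<..grid T m (Suc i)} = {}"
        proof (rule ccontr)
          assume "\<not> ?thesis"
          then obtain u where u: "u \<in> C'" "u \<in> {grid T m i<..grid T m (Suc i)}" by blast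
          moreover have "u \<in> {0<..T}" using u(2) iT grid_nonneg[of T m i] T by (auto simp del: grid_nonneg)
          ultimately show False using cell_eqI[OF T elim(2) u(2)] i by (auto simp: C_def)
        qed
        then have "\<bar>?I m i\<bar> < 1" using C'(2) T iT grid_mono[of T i "Suc i" m] by simp
        then show "g (?I m i) = 0" using g(2) by simp
      qed
    qed simp
    finally show ?case .
  qed
  moreover have "(\<lambda>m. \<Sum>u\<in>C. g (?I m (cell T m u))) \<longlonglongrightarrow> (\<Sum>u\<in>C. g (jump L u \<omega>))"
  proof (rule tendsto_sum)
    fix u assume "u \<in> C"
    then have u: "u \<in> {0<..T}" using C by auto
    show "(\<lambda>m. g (?I m (cell T m u))) \<longlonglongrightarrow> g (jump L u \<omega>)"
      by (rule continuous_on_tendsto_compose[OF g(1) cell_increment_tendsto_jump[of T L \<omega> u, OF L T u]]) auto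
  qed
  moreover have "(\<Sum>\<^sub>\<infinity>u\<in>{0<..T}. g (jump L u \<omega>)) = (\<Sum>u\<in>C. g (jump L u \<omega>))"
    by (rule infsum_jumps[of T L \<omega> g C, OF L T g(2) C big])
  ultimately show ?thesis by (simp only:) (rule Lim_transform_eventually)
qed

section \<open>Independent increments over a grid\<close>

locale levy_on_horizon = prob_space P
  for P :: "'a measure" +
  fixes F :: "real \<Rightarrow> 'a measure" and T :: real and L :: "real \<Rightarrow> 'a \<Rightarrow> real"
  assumes horizon_pos: "0 < T"
    and filtr: "filtration (space P) (extend_horizon T F)"
    and subalg: "\<And>t. t \<in> {0..T} \<Longrightarrow> subalgebra P (F t)"
    and levy: "levy_process P F T L"
begin

abbreviation incr :: "nat \<Rightarrow> nat \<Rightarrow> 'a \<Rightarrow> real" where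
  "incr m i \<omega> \<equiv> L (grid T m (Suc i)) \<omega> - L (grid T m i) \<omega>"

lemma horizon_nonneg [simp]: "0 \<le> T" using horizon_pos by simp

lemma space_F [simp]: "t \<in> {0..T} \<Longrightarrow> space (F t) = space P"
  using subalg by (auto simp: subalgebra_def)

lemma sets_F_mono:
  assumes "0 \<le> s" "s \<le> t" "t \<le> T"
  shows "sets (F s) \<subseteq> sets (F t)"
proof -
  have "sets (extend_horizon T F s) \<subseteq> sets (extend_horizon T F t)"
    by (rule filtration.sets_F_mono[OF filtr assms(2)])
  then show ?thesis using assms by (simp add: extend_horizon_def)
qed

lemma F_mono_measurable:
  assumes "0 \<le> s" "s \<le> t" "t \<le> T" "f \<in> measurable (F s) N"
  shows "f \<in> measurable (F t) N"
proof -
  have "space (F s) = space (F t)" using assms by simp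
  then show ?thesis using assms sets_F_mono[OF assms(1-3)] by (auto simp: measurable_def)
qed

lemma F_P_measurable:
  assumes "t \<in> {0..T}" "f \<in> measurable (F t) N"
  shows "f \<in> measurable P N"
  using measurable_from_subalg[OF subalg[OF assms(1)] assms(2)] .

lemma L_adapted: "0 \<le> s \<Longrightarrow> s \<le> t \<Longrightarrow> t \<le> T \<Longrightarrow> L s \<in> borel_measurable (F t)"
  using levy F_mono_measurable[of s t "L s" borel] by (auto simp: levy_process_def)

lemma L_measurable: "0 \<le> t \<Longrightarrow> t \<le> T \<Longrightarrow> L t \<in> borel_measurable P"
  by (rule F_P_measurable[OF _ L_adapted[of t t]]) auto

lemma L_0: "\<omega> \<in> space P \<Longrightarrow> L 0 \<omega> = 0"
  using levy by (auto simp: levy_process_def)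

lemma L_cadlag: "\<omega> \<in> space P \<Longrightarrow> cadlag_on T (\<lambda>t. L t \<omega>)"
  using levy by (auto simp: levy_process_def)

lemma increment_stationary:
  assumes st: "0 \<le> s" "s \<le> t" "t \<le> T" and h: "h \<in> borel_measurable borel"
  shows "(\<integral>\<^sup>+\<omega>. h (L t \<omega> - L s \<omega>) \<partial>P) = (\<integral>\<^sup>+\<omega>. h (L (t - s) \<omega>) \<partial>P)"
proof -
  have m: "(\<lambda>\<omega>. L t \<omega> - L s \<omega>) \<in> borel_measurable P" "(\<lambda>\<omega>. L (t - s) \<omega> - L 0 \<omega>) \<in> borel_measurable P"
    using st L_measurable[of t] L_measurable[of s] L_measurable[of "t - s"] L_measurable[of 0] by auto
  have "\<forall>s t h. 0 \<le> s \<and> 0 \<le> t \<and> 0 \<le> h \<and> s + h \<le> T \<and> t + h \<le> T \<longrightarrow>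
        distr P borel (\<lambda>\<omega>. L (s + h) \<omega> - L s \<omega>) = distr P borel (\<lambda>\<omega>. L (t + h) \<omega> - L t \<omega>)"
    using levy by (auto simp: levy_process_def)
  from this[rule_format, of s 0 "t - s"] st
  have d: "distr P borel (\<lambda>\<omega>. L t \<omega> - L s \<omega>) = distr P borel (\<lambda>\<omega>. L (t - s) \<omega> - L 0 \<omega>)" by simp
  have "(\<integral>\<^sup>+\<omega>. h (L t \<omega> - L s \<omega>) \<partial>P) = (\<integral>\<^sup>+x. h x \<partial>distr P borel (\<lambda>\<omega>. L t \<omega> - L s \<omega>))"
    by (simp add: nn_integral_distr m h)
  also have "\<dots> = (\<integral>\<^sup>+\<omega>. h (L (t - s) \<omega> - L 0 \<omega>) \<partial>P)"
    unfolding d by (simp add: nn_integral_distr m h)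
  also have "\<dots> = (\<integral>\<^sup>+\<omega>. h (L (t - s) \<omega>) \<partial>P)"
    by (intro nn_integral_cong) (simp add: L_0)
  finally show ?thesis .
qed

text \<open>The past enters only through the \<open>F s\<close>-measurable factor \<open>V\<close>, so the products of functions of
  successive increments, or indicators of events before \<open>s\<close>, can be split off.\<close>
lemma increment_indep:
  assumes st: "0 \<le> s" "s \<le> t" "t \<le> T" and h: "h \<in> borel_measurable borel"
    and V: "V \<in> borel_measurable (F s)"
  shows "(\<integral>\<^sup>+\<omega>. h (L t \<omega> - L s \<omega>) * V \<omega> \<partial>P) = (\<integral>\<^sup>+\<omega>. h (L (t - s) \<omega>) \<partial>P) * (\<integral>\<^sup>+\<omega>. (V \<omega> :: ennreal) \<partial>P)"
proof -
  let ?X = "\<lambda>\<omega>. L t \<omega> - L s \<omega>"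
  have sF: "subalgebra P (F s)" and spF: "space (F s) = space P" using subalg[of s] st by auto
  have mX: "?X \<in> borel_measurable P" using st L_measurable[of t] L_measurable[of s] by auto
  have ind: "indep_set (sets (vimage_algebra (space P) ?X borel)) (sets (F s))"
    using levy st by (auto simp: levy_process_def)
  have mV: "V \<in> borel_measurable P" using measurable_from_subalg[OF sF V] .
  have mh: "h \<circ> ?X \<in> borel_measurable P" using mX h by (rule measurable_comp)
  have "sigma_sets (space P) {(h \<circ> ?X) -` A \<inter> space P |A. A \<in> sets borel}
      \<subseteq> sets (vimage_algebra (space P) ?X borel)"
  proof -
    have "(h \<circ> ?X) -` A \<inter> space P \<in> sets (vimage_algebra (space P) ?X borel)" if "A \<in> sets borel" for A
      using in_vimage_algebra[OF measurable_sets_borel[OF h that], of ?X "space P"] by (simp add: vimage_comp)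
    then show ?thesis
      using sets.sigma_sets_subset[of "{(h \<circ> ?X) -` A \<inter> space P |A. A \<in> sets borel}"
          "vimage_algebra (space P) ?X borel"] by auto
  qed
  moreover have "sigma_sets (space P) {V -` A \<inter> space P |A. A \<in> sets borel} \<subseteq> sets (F s)"
    using sets.sigma_sets_subset[of "{V -` A \<inter> space P |A. A \<in> sets borel}" "F s"]
      measurable_sets[OF V] spF by auto
  ultimately have "indep_set (sigma_sets (space P) {(h \<circ> ?X) -` A \<inter> space P |A. A \<in> sets borel})
     (sigma_sets (space P) {V -` A \<inter> space P |A. A \<in> sets borel})"
    using ind unfolding indep_sets2_eq by blast
  then have "indep_var borel (h \<circ> ?X) borel V"
    unfolding indep_var_eq using mh mV by blast
  moreover have case_borel: "case_bool borel borel = (\<lambda>_. borel :: ennreal measure)"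
    by (rule ext) (simp split: bool.split)
  ultimately have "indep_vars (\<lambda>_. borel) (case_bool (h \<circ> ?X) V) UNIV"
    unfolding indep_var_def by (simp only: case_borel)
  from indep_vars_nn_integral[OF _ this]
  have "(\<integral>\<^sup>+\<omega>. h (?X \<omega>) * V \<omega> \<partial>P) = (\<integral>\<^sup>+\<omega>. h (?X \<omega>) \<partial>P) * (\<integral>\<^sup>+\<omega>. V \<omega> \<partial>P)"
    by (simp add: UNIV_bool mult.commute o_def)
  then show ?thesis using increment_stationary[OF st h] by simp
qed

lemma grid_product_measurable:
  assumes "k \<le> m" "h \<in> borel_measurable borel"
  shows "(\<lambda>\<omega>. \<Prod>i<k. (h (incr m i \<omega>) :: ennreal)) \<in> borel_measurable (F (grid T m k))"
proof (intro borel_measurable_prod_ennreal measurable_compose[OF _ assms(2)] borel_measurable_diff)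
  fix i assume i: "i \<in> {..<k}"
  have "grid T m i \<le> grid T m k" "grid T m (Suc i) \<le> grid T m k" "grid T m k \<le> T"
    using i assms by (auto intro!: grid_mono grid_le_horizon)
  then show "L (grid T m (Suc i)) \<in> borel_measurable (F (grid T m k))"
    "L (grid T m i) \<in> borel_measurable (F (grid T m k))"
    by (auto intro!: L_adapted)
qed

lemma grid_product:
  assumes m: "0 < m" and h: "h \<in> borel_measurable borel"
  shows "k \<le> m \<Longrightarrow> (\<integral>\<^sup>+\<omega>. (\<Prod>i<k. h (incr m i \<omega>)) \<partial>P) = (\<integral>\<^sup>+\<omega>. h (L (T / real m) \<omega>) \<partial>P) ^ k"
proof (induction k)
  case 0
  then show ?case by (simp add: emeasure_space_1)
next
  case (Suc k)
  have g: "grid T m (Suc k) - grid T m k = T / real m" by (simp add: grid_Suc)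
  have "(\<integral>\<^sup>+\<omega>. (\<Prod>i<Suc k. h (incr m i \<omega>)) \<partial>P) = (\<integral>\<^sup>+\<omega>. h (incr m k \<omega>) * (\<Prod>i<k. h (incr m i \<omega>)) \<partial>P)"
    by (simp add: mult.commute)
  also have "\<dots> = (\<integral>\<^sup>+\<omega>. h (L (T / real m) \<omega>) \<partial>P) * (\<integral>\<^sup>+\<omega>. (\<Prod>i<k. h (incr m i \<omega>)) \<partial>P)"
    unfolding g[symmetric]
    by (rule increment_indep[OF _ _ _ h grid_product_measurable[OF _ h]])
       (use Suc in \<open>auto intro!: grid_mono grid_le_horizon\<close>)
  finally show ?case using Suc by simp
qed

end

section \<open>Large jumps\<close>

text \<open>Continuous functions that vanish on \<open>[-1, 1]\<close> and tend to the indicator function of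
  \<open>{x. 1 < \<bar>x\<bar>}\<close>.  They make the convergence of grid sums, which requires continuity, available for
  functions that jump at \<open>\<plusminus>1\<close>.\<close>
definition ramp :: "nat \<Rightarrow> real \<Rightarrow> real" where
  "ramp k x = min 1 (max 0 (real k * (\<bar>x\<bar> - 1)))"

lemma ramp_eq_0: "\<bar>x\<bar> \<le> 1 \<Longrightarrow> ramp k x = 0"
  using mult_nonneg_nonpos[of "real k" "\<bar>x\<bar> - 1"] by (simp add: ramp_def max_def)

lemma ramp_bounds: "0 \<le> ramp k x" "ramp k x \<le> 1" by (auto simp: ramp_def)

lemma ramp_tendsto: "(\<lambda>k. ramp k x) \<longlonglongrightarrow> (if 1 < \<bar>x\<bar> then 1 else 0)"
proof (cases "1 < \<bar>x\<bar>")
  case True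
  obtain N :: nat where N: "1 \<le> real N * (\<bar>x\<bar> - 1)"
    using reals_Archimedean3[of "\<bar>x\<bar> - 1"] True by (meson diff_gt_0_iff_gt less_imp_le)
  have "eventually (\<lambda>k. ramp k x = 1) sequentially"
    using eventually_ge_at_top[of N]
  proof eventually_elim
    case (elim k)
    have "real N * (\<bar>x\<bar> - 1) \<le> real k * (\<bar>x\<bar> - 1)" using elim True by (intro mult_right_mono) auto
    then show ?case using N by (simp add: ramp_def)
  qed
  then show ?thesis using True by (simp add: tendsto_eventually)
next
  case False
  then show ?thesis by (simp add: ramp_eq_0)
qed

lemma continuous_on_ramp [continuous_intros]: "continuous_on UNIV (ramp k)"
  unfolding ramp_def by (intro continuous_intros)

lemma ramp_measurable [measurable]: "ramp k \<in> borel_measurable borel"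
  by (intro borel_measurable_continuous_onI continuous_on_ramp)

context levy_on_horizon
begin

text \<open>An iterated limit of grid sums: first the grid is refined for a continuous function \<open>g ramp\<^sub>k\<close> of the
  jumps, then \<open>k\<close> tends to infinity.\<close>
lemma jump_sum_measurable:
  assumes g: "continuous_on UNIV (g :: real \<Rightarrow> real)"
  shows "(\<lambda>\<omega>. \<Sum>\<^sub>\<infinity>u\<in>{0<..T}. if 1 < \<bar>jump L u \<omega>\<bar> then g (jump L u \<omega>) else 0) \<in> borel_measurable (F T)"
proof (rule borel_measurable_LIMSEQ_real)
  let ?J = "\<lambda>k \<omega>. \<Sum>\<^sub>\<infinity>u\<in>{0<..T}. g (jump L u \<omega>) * ramp k (jump L u \<omega>)"
  show "?J k \<in> borel_measurable (F T)" for k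
  proof (rule borel_measurable_LIMSEQ_real)
    fix \<omega> assume "\<omega> \<in> space (F T)"
    then have "\<omega> \<in> space P" by simp
    then show "(\<lambda>m. \<Sum>i<m. g (incr m i \<omega>) * ramp k (incr m i \<omega>)) \<longlonglongrightarrow> ?J k \<omega>"
      by (intro grid_sum_tendsto_jump_sum[of T L \<omega> "\<lambda>x. g x * ramp k x"] L_cadlag horizon_pos
           continuous_intros g) (auto simp: ramp_eq_0)
  next
    fix m
    have [measurable]: "g \<in> borel_measurable borel" using g by (rule borel_measurable_continuous_onI)
    have "incr m i \<in> borel_measurable (F T)" if "i < m" for i
      using that by (intro borel_measurable_diff L_adapted grid_le_horizon grid_nonneg) auto
    then show "(\<lambda>\<omega>. \<Sum>i<m. g (incr m i \<omega>) * ramp k (incr m i \<omega>)) \<in> borel_measurable (F T)"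
      by (intro borel_measurable_sum borel_measurable_times measurable_compose[of "incr m _" _ borel g]
            measurable_compose[of "incr m _" _ borel "ramp k"]) auto
  qed
  fix \<omega> assume "\<omega> \<in> space (F T)"
  then have \<omega>: "cadlag_on T (\<lambda>t. L t \<omega>)" using L_cadlag by simp
  let ?C = "{u\<in>{0<..T}. 1 < \<bar>jump L u \<omega>\<bar>}"
  have C: "finite ?C" by (rule finite_large_jumps[of T L \<omega>, OF \<omega> horizon_pos])
  have 1: "?J k \<omega> = (\<Sum>u\<in>?C. g (jump L u \<omega>) * ramp k (jump L u \<omega>))" for k
    by (rule infsum_jumps[of T L \<omega> "\<lambda>x. g x * ramp k x" ?C, OF \<omega> horizon_pos _ C]) (auto simp: ramp_eq_0)
  have 2: "(\<Sum>\<^sub>\<infinity>u\<in>{0<..T}. if 1 < \<bar>jump L u \<omega>\<bar> then g (jump L u \<omega>) else 0)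
      = (\<Sum>u\<in>?C. g (jump L u \<omega>) * (if 1 < \<bar>jump L u \<omega>\<bar> then 1 else 0))"
    by (subst infsum_jumps[of T L \<omega> "\<lambda>x. if 1 < \<bar>x\<bar> then g x else 0" ?C, OF \<omega> horizon_pos _ C]) auto
  show "(\<lambda>k. ?J k \<omega>) \<longlonglongrightarrow> (\<Sum>\<^sub>\<infinity>u\<in>{0<..T}. if 1 < \<bar>jump L u \<omega>\<bar> then g (jump L u \<omega>) else 0)"
    unfolding 1 2 by (intro tendsto_sum tendsto_mult tendsto_const ramp_tendsto)
qed

text \<open>By right-continuity at \<open>0\<close> the path stays within \<open>[-1/2, 1/2]\<close> up to some time \<open>T / M\<close> with
  probability more than \<open>1/2\<close>.  On this event the \<open>j\<close> independent increments over a grid of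
  \<open>[0, T / M]\<close> are bounded by \<open>1\<close>, so \<open>(1 - p)^j > 1/2\<close> for the probability \<open>p\<close> of one large increment, whence
  \<open>j p \<le> 1\<close>.\<close>
lemma large_increment_rate:
  "\<exists>M::nat. 0 < M \<and>
    (\<forall>j>0. real (M * j) * prob {\<omega>\<in>space P. 1 < \<bar>L (T / real (M * j)) \<omega>\<bar>} \<le> real M)"
proof -
  define B where "B q = {\<omega>\<in>space P. \<forall>r\<in>\<rat>. 0 \<le> r \<and> r \<le> 1 / real (Suc q) \<longrightarrow> \<bar>L (T * r) \<omega>\<bar> \<le> 1 / 2}" for q
  have B_eq: "B q = {\<omega>\<in>space P. \<forall>r\<in>(\<rat> \<inter> {0..1 / real (Suc q)}). \<bar>L (T * r) \<omega>\<bar> \<le> 1 / 2}" for q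
    by (auto simp: B_def)
  have rT: "T * r \<le> T" if "r \<le> 1 / real (Suc q)" for r q
  proof -
    have "r \<le> 1" using that by (rule order_trans) (simp add: field_simps)
    then show ?thesis using horizon_pos by (simp add: mult_left_le)
  qed
  have B: "B q \<in> events" for q
    unfolding B_eq
  proof (rule sets.sets_Collect_countable_All')
    show "countable (\<rat> \<inter> {0..1 / real (Suc q)})" by (intro countable_Int1 countable_rat)
    fix r assume "r \<in> \<rat> \<inter> {0..1 / real (Suc q)}"
    then have "L (T * r) \<in> borel_measurable P" using rT[of r q] by (intro L_measurable) auto
    then show "{\<omega> \<in> space P. \<bar>L (T * r) \<omega>\<bar> \<le> 1 / 2} \<in> events" by measurable
  qed
  have "incseq B"
    unfolding B_def by (intro incseq_SucI) (force elim: order_trans intro: divide_left_mono)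
  have UB: "(\<Union>q. B q) = space P"
  proof (intro equalityI subsetI)
    fix \<omega> assume \<omega>: "\<omega> \<in> space P"
    have "((\<lambda>t. L t \<omega>) \<longlongrightarrow> L 0 \<omega>) (at_right 0)"
      using L_cadlag[OF \<omega>] horizon_pos by (auto simp: cadlag_on_def continuous_within)
    then have "eventually (\<lambda>t. dist (L t \<omega>) (L 0 \<omega>) < 1 / 2) (at_right 0)" by (intro tendstoD) auto
    then obtain b where b: "b > 0" "\<And>t. 0 < t \<Longrightarrow> t < b \<Longrightarrow> \<bar>L t \<omega>\<bar> < 1 / 2"
      using L_0[OF \<omega>] by (auto simp: eventually_at_right_field dist_real_def)
    obtain q where q: "T / real (Suc q) < b"
      using order_tendstoD(2)[OF LIMSEQ_Suc[OF lim_const_over_n[of T]] b(1)]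
      by (auto simp: eventually_sequentially)
    have "\<bar>L (T * r) \<omega>\<bar> \<le> 1 / 2" if r: "0 \<le> r" "r \<le> 1 / real (Suc q)" for r
    proof (cases "r = 0")
      case False
      have "T * r \<le> T * (1 / real (Suc q))" using r by (intro mult_left_mono) auto
      then have "T * r < b" using q by simp
      then show ?thesis using b(2)[of "T * r"] False r horizon_pos by auto
    qed (simp add: L_0[OF \<omega>])
    then show "\<omega> \<in> (\<Union>q. B q)" using \<omega> by (auto simp: B_def)
  qed (auto simp: B_def)
  have "(\<lambda>q. prob (B q)) \<longlonglongrightarrow> prob (\<Union>q. B q)"
    by (rule finite_Lim_measure_incseq) (use B \<open>incseq B\<close> in auto)
  then have "(\<lambda>q. prob (B q)) \<longlonglongrightarrow> 1" by (simp add: UB prob_space)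
  then have "eventually (\<lambda>q. 1 / 2 < prob (B q)) sequentially" by (rule order_tendstoD) simp
  then obtain q where q: "1 / 2 < prob (B q)" by (auto simp: eventually_sequentially)
  define M where "M = Suc q"
  show ?thesis
  proof (intro exI[of _ M] conjI allI impI)
    show "0 < M" by (simp add: M_def)
    fix j :: nat assume j: "0 < j"
    define m where "m = M * j"
    have m: "0 < m" "j \<le> m" using j by (auto simp: m_def M_def)
    have Tm: "0 \<le> T / real m" "T / real m \<le> T"
      using m horizon_pos by (auto simp: field_simps)
    define p where "p = prob {\<omega>\<in>space P. 1 < \<bar>L (T / real m) \<omega>\<bar>}"
    have [measurable]: "L (T / real m) \<in> borel_measurable P" using L_measurable Tm by simp
    define h :: "real \<Rightarrow> ennreal" where "h = indicator {x. \<bar>x\<bar> \<le> 1}"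
    have h[measurable]: "h \<in> borel_measurable borel" unfolding h_def by measurable
    have "(\<integral>\<^sup>+\<omega>. h (L (T / real m) \<omega>) \<partial>P) = (\<integral>\<^sup>+\<omega>. indicator {\<omega>\<in>space P. \<bar>L (T / real m) \<omega>\<bar> \<le> 1} \<omega> \<partial>P)"
      by (intro nn_integral_cong) (auto simp: h_def indicator_def)
    also have "\<dots> = ennreal (prob {\<omega>\<in>space P. \<bar>L (T / real m) \<omega>\<bar> \<le> 1})"
      by (subst nn_integral_indicator) (auto simp: emeasure_eq_measure)
    also have "{\<omega>\<in>space P. \<bar>L (T / real m) \<omega>\<bar> \<le> 1} = space P - {\<omega>\<in>space P. 1 < \<bar>L (T / real m) \<omega>\<bar>}" by auto
    also have "prob \<dots> = 1 - p" unfolding p_def by (rule prob_compl) measurable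
    finally have hp: "(\<integral>\<^sup>+\<omega>. h (L (T / real m) \<omega>) \<partial>P) = ennreal (1 - p)" .
    have p01: "0 \<le> p" "p \<le> 1" by (auto simp: p_def)
    have "ennreal (prob (B q)) = (\<integral>\<^sup>+\<omega>. indicator (B q) \<omega> \<partial>P)"
      using B by (simp add: emeasure_eq_measure)
    also have "\<dots> \<le> (\<integral>\<^sup>+\<omega>. (\<Prod>i<j. h (incr m i \<omega>)) \<partial>P)"
    proof (intro nn_integral_mono)
      fix \<omega> assume "\<omega> \<in> space P"
      have "\<bar>incr m i \<omega>\<bar> \<le> 1" if "\<omega> \<in> B q" "i < j" for i
      proof -
        have *: "\<bar>L (grid T m k) \<omega>\<bar> \<le> 1 / 2" if "k \<le> j" for k
        proof -
          have "real k / real m \<le> 1 / real (Suc q)"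
            using that j mult_right_mono[OF that, of "Suc q"]
            by (simp add: m_def M_def field_simps flip: of_nat_mult of_nat_add of_nat_Suc)
          moreover have "real k / real m \<in> \<rat>" by simp
          ultimately have "\<bar>L (T * (real k / real m)) \<omega>\<bar> \<le> 1 / 2"
            using \<open>\<omega> \<in> B q\<close> unfolding B_def by (simp del: times_divide_eq_right)
          then show ?thesis by (simp add: grid_def)
        qed
        show ?thesis using *[of i] *[of "Suc i"] that by auto
      qed
      then show "indicator (B q) \<omega> \<le> (\<Prod>i<j. h (incr m i \<omega>))"
        by (auto simp: indicator_def h_def)
    qed
    also have "\<dots> = ennreal ((1 - p) ^ j)"
      using grid_product[OF m(1) h m(2)] hp p01 by (simp add: ennreal_power)
    finally have "prob (B q) \<le> (1 - p) ^ j" using p01 by (subst (asm) ennreal_le_iff) auto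
    then have half: "1 / 2 < (1 - p) ^ j" using q by simp
    \<comment> \<open>Bernoulli: \<open>(1 - p)^j (1 + j p) \<le> (1 - p)^j (1 + p)^j \<le> 1\<close>.\<close>
    have "(1 - p) ^ j * (1 + real j * p) \<le> (1 - p) ^ j * (1 + p) ^ j"
      using Bernoulli_inequality[of p j] p01 by (intro mult_left_mono) (auto simp: mult.commute)
    also have "\<dots> = ((1 - p) * (1 + p)) ^ j" by (simp add: power_mult_distrib)
    also have "\<dots> \<le> 1" using p01 by (intro power_le_one) (auto simp: algebra_simps mult_le_one)
    finally have 1: "(1 - p) ^ j * (1 + real j * p) \<le> 1" .
    have "1 / 2 * (1 + real j * p) \<le> (1 - p) ^ j * (1 + real j * p)"
      using half p01 by (intro mult_right_mono) auto
    from order_trans[OF this 1] have "real j * p \<le> 1" by simp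
    then have "real M * (real j * p) \<le> real M * 1" by (intro mult_left_mono) auto
    then show "real (M * j) * prob {\<omega>\<in>space P. 1 < \<bar>L (T / real (M * j)) \<omega>\<bar>} \<le> real M"
      by (simp add: p_def m_def mult.assoc)
  qed
qed

text \<open>The number of large jumps is a limit of limits of grid sums that are dominated by the number of large
  increments.  The expectation of the latter is bounded by the previous lemma, and Fatou's lemma, applied
  twice, carries the bound over.\<close>
lemma expected_large_jumps_finite:
  "(\<integral>\<^sup>+\<omega>. emeasure (count_space UNIV) {u\<in>{0<..T}. 1 < \<bar>jump L u \<omega>\<bar>} \<partial>P) < \<infinity>"
proof -
  obtain M :: nat where M: "0 < M"
    "\<And>j. 0 < j \<Longrightarrow> real (M * j) * prob {\<omega>\<in>space P. 1 < \<bar>L (T / real (M * j)) \<omega>\<bar>} \<le> real M"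
    using large_increment_rate by blast
  define R where "R k \<omega> = (\<Sum>\<^sub>\<infinity>u\<in>{0<..T}. ramp k (jump L u \<omega>))" for k \<omega>
  define A where "A k j \<omega> = (\<Sum>i<M * j. ramp k (incr (M * j) i \<omega>))" for k j \<omega>
  have inc: "incr m i \<in> borel_measurable P" if "i < m" for i m
    using that by (intro borel_measurable_diff L_measurable grid_le_horizon grid_nonneg) auto
  have A_meas: "A k j \<in> borel_measurable P" for k j
    unfolding A_def using inc by (intro borel_measurable_sum measurable_compose[of "incr _ _" _ borel "ramp k"]) auto
  have lim: "(\<lambda>j. A k j \<omega>) \<longlonglongrightarrow> R k \<omega>" if "\<omega> \<in> space P" for k \<omega>
  proof -
    have "(\<lambda>m. \<Sum>i<m. ramp k (incr m i \<omega>)) \<longlonglongrightarrow> R k \<omega>"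
      unfolding R_def using that
      by (intro grid_sum_tendsto_jump_sum[of T L \<omega> "ramp k"] L_cadlag horizon_pos continuous_on_ramp ramp_eq_0)
    from LIMSEQ_subseq_LIMSEQ[OF this, of "\<lambda>j. M * j"] show ?thesis
      using M(1) by (simp add: strict_mono_def o_def A_def)
  qed
  have R_meas: "R k \<in> borel_measurable P" for k
    by (rule borel_measurable_LIMSEQ_real[OF lim A_meas])
  have A_int: "(\<integral>\<^sup>+\<omega>. ennreal (A k j \<omega>) \<partial>P) \<le> ennreal (real M)" if j: "0 < j" for k j
  proof -
    have mpos: "0 < M * j" using M(1) j by simp
    let ?h = "indicator {x. 1 < \<bar>x\<bar>} :: real \<Rightarrow> ennreal"
    have h: "?h \<in> borel_measurable borel" by (intro borel_measurable_indicator) measurable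
    have TL: "0 \<le> T / real (M * j)" "T / real (M * j) \<le> T"
      using mpos horizon_pos by (auto simp: field_simps simp flip: of_nat_mult)
    then have [measurable]: "L (T / real (M * j)) \<in> borel_measurable P" by (rule L_measurable)
    have "(\<integral>\<^sup>+\<omega>. ennreal (A k j \<omega>) \<partial>P) \<le> (\<integral>\<^sup>+\<omega>. (\<Sum>i<M * j. ?h (incr (M * j) i \<omega>)) \<partial>P)"
    proof (intro nn_integral_mono)
      fix \<omega>
      have "ennreal (A k j \<omega>) = (\<Sum>i<M * j. ennreal (ramp k (incr (M * j) i \<omega>)))"
        unfolding A_def by (simp add: ramp_bounds sum_ennreal)
      also have "\<dots> \<le> (\<Sum>i<M * j. ?h (incr (M * j) i \<omega>))"
        by (intro sum_mono) (use ramp_bounds(2) in \<open>auto simp: indicator_def ramp_eq_0 not_less\<close>)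
      finally show "ennreal (A k j \<omega>) \<le> (\<Sum>i<M * j. ?h (incr (M * j) i \<omega>))" .
    qed
    also have "\<dots> = (\<Sum>i<M * j. \<integral>\<^sup>+\<omega>. ?h (incr (M * j) i \<omega>) \<partial>P)"
      by (intro nn_integral_sum measurable_compose[OF inc h]) auto
    also have "\<dots> = (\<Sum>i<M * j. \<integral>\<^sup>+\<omega>. ?h (L (T / real (M * j)) \<omega>) \<partial>P)"
    proof (intro sum.cong refl)
      fix i assume "i \<in> {..<M * j}"
      then show "(\<integral>\<^sup>+\<omega>. ?h (incr (M * j) i \<omega>) \<partial>P) = (\<integral>\<^sup>+\<omega>. ?h (L (T / real (M * j)) \<omega>) \<partial>P)"
        using increment_stationary[OF _ _ _ h, of "grid T (M * j) i" "grid T (M * j) (Suc i)"]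
          grid_mono[of T i "Suc i" "M * j"] grid_le_horizon[of T "Suc i" "M * j"] by (simp add: grid_Suc)
    qed
    also have "(\<integral>\<^sup>+\<omega>. ?h (L (T / real (M * j)) \<omega>) \<partial>P) = (\<integral>\<^sup>+\<omega>. indicator {\<omega>\<in>space P. 1 < \<bar>L (T / real (M * j)) \<omega>\<bar>} \<omega> \<partial>P)"
      by (intro nn_integral_cong) (auto simp: indicator_def)
    also have "\<dots> = emeasure P {\<omega>\<in>space P. 1 < \<bar>L (T / real (M * j)) \<omega>\<bar>}"
      by (rule nn_integral_indicator) measurable
    also have "\<dots> = ennreal (prob {\<omega>\<in>space P. 1 < \<bar>L (T / real (M * j)) \<omega>\<bar>})"
      by (rule emeasure_eq_measure)
    also have "(\<Sum>i<M * j. \<dots>) = ennreal (real (M * j) * prob {\<omega>\<in>space P. 1 < \<bar>L (T / real (M * j)) \<omega>\<bar>})"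
      by (simp add: ennreal_mult ennreal_of_nat_eq_real_of_nat)
    also have "\<dots> \<le> ennreal (real M)" using M(2)[OF j] by (rule ennreal_leI)
    finally show ?thesis .
  qed
  have R_int: "(\<integral>\<^sup>+\<omega>. ennreal (R k \<omega>) \<partial>P) \<le> ennreal (real M)" for k
  proof -
    have "(\<integral>\<^sup>+\<omega>. ennreal (R k \<omega>) \<partial>P) = (\<integral>\<^sup>+\<omega>. liminf (\<lambda>j. ennreal (A k j \<omega>)) \<partial>P)"
      by (intro nn_integral_cong lim_imp_Liminf[symmetric] tendsto_ennrealI lim) auto
    also have "\<dots> \<le> liminf (\<lambda>j. \<integral>\<^sup>+\<omega>. ennreal (A k j \<omega>) \<partial>P)"
      using A_meas by (intro nn_integral_liminf) auto
    also have "\<dots> \<le> ennreal (real M)"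
      by (intro Liminf_le eventually_mono[OF eventually_gt_at_top[of 0] A_int]) auto
    finally show ?thesis .
  qed
  have "(\<integral>\<^sup>+\<omega>. emeasure (count_space UNIV) {u\<in>{0<..T}. 1 < \<bar>jump L u \<omega>\<bar>} \<partial>P)
      = (\<integral>\<^sup>+\<omega>. liminf (\<lambda>k. ennreal (R k \<omega>)) \<partial>P)"
  proof (intro nn_integral_cong lim_imp_Liminf[symmetric])
    fix \<omega> assume "\<omega> \<in> space P"
    then have \<omega>: "cadlag_on T (\<lambda>t. L t \<omega>)" by (rule L_cadlag)
    let ?C = "{u\<in>{0<..T}. 1 < \<bar>jump L u \<omega>\<bar>}"
    have C: "finite ?C" by (rule finite_large_jumps[of T L \<omega>, OF \<omega> horizon_pos])
    have R_eq: "R k \<omega> = (\<Sum>u\<in>?C. ramp k (jump L u \<omega>))" for k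
      unfolding R_def by (rule infsum_jumps[of T L \<omega> "ramp k" ?C, OF \<omega> horizon_pos _ C]) (auto simp: ramp_eq_0)
    have "(\<lambda>k. R k \<omega>) \<longlonglongrightarrow> (\<Sum>u\<in>?C. if 1 < \<bar>jump L u \<omega>\<bar> then 1 else 0)"
      unfolding R_eq by (intro tendsto_sum ramp_tendsto)
    then have "(\<lambda>k. R k \<omega>) \<longlonglongrightarrow> real (card ?C)" by simp
    from tendsto_ennrealI[OF this]
    show "(\<lambda>k. ennreal (R k \<omega>)) \<longlonglongrightarrow> emeasure (count_space UNIV) ?C"
      using C by (simp add: ennreal_of_nat_eq_real_of_nat)
  qed auto
  also have "\<dots> \<le> liminf (\<lambda>k. \<integral>\<^sup>+\<omega>. ennreal (R k \<omega>) \<partial>P)"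
    using R_meas by (intro nn_integral_liminf) auto
  also have "\<dots> \<le> ennreal (real M)"
    by (intro Liminf_le always_eventually allI R_int) auto
  also have "\<dots> < \<infinity>" by simp
  finally show ?thesis .
qed

end

section \<open>Monotone Levy processes\<close>

lemma levy_process_uminus:
  assumes P: "prob_space P" and F: "\<And>t. t \<in> {0..T} \<Longrightarrow> subalgebra P (F t)"
    and L: "levy_process P F T L"
  shows "levy_process P F T (\<lambda>t \<omega>. - L t \<omega>)"
proof -
  note Ld = L[unfolded levy_process_def]
  note L_ad = Ld[THEN conjunct1]
    and L_0 = Ld[THEN conjunct2, THEN conjunct1]
    and L_cad = Ld[THEN conjunct2, THEN conjunct2, THEN conjunct1]
    and L_stat = Ld[THEN conjunct2, THEN conjunct2, THEN conjunct2, THEN conjunct1]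
    and L_ind = Ld[THEN conjunct2, THEN conjunct2, THEN conjunct2, THEN conjunct2]
  have Lm: "L t \<in> borel_measurable P" if "t \<in> {0..T}" for t
    using measurable_from_subalg[OF F[OF that] L_ad[rule_format, OF that]] .
  have A: "distr P borel (\<lambda>\<omega>. - L (s + h) \<omega> - - L s \<omega>) = distr P borel (\<lambda>\<omega>. - L (t + h) \<omega> - - L t \<omega>)"
    if "0 \<le> s" "0 \<le> t" "0 \<le> h" "s + h \<le> T" "t + h \<le> T" for s t h
  proof -
    have *: "distr P borel (\<lambda>\<omega>. - L (r + h) \<omega> - - L r \<omega>)
        = distr (distr P borel (\<lambda>\<omega>. L (r + h) \<omega> - L r \<omega>)) borel uminus" if "0 \<le> r" "r + h \<le> T" for r
      
    proof (subst distr_distr)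
      show "(\<lambda>\<omega>. L (r + h) \<omega> - L r \<omega>) \<in> borel_measurable P"
        using that \<open>0 \<le> h\<close> by (intro borel_measurable_diff Lm) auto
    qed (simp_all add: o_def)
    have "distr P borel (\<lambda>\<omega>. L (s + h) \<omega> - L s \<omega>) = distr P borel (\<lambda>\<omega>. L (t + h) \<omega> - L t \<omega>)"
      using L_stat that by blast
    then show ?thesis unfolding *[OF that(1,4)] *[OF that(2,5)] by (rule arg_cong)
  qed
  have B: "sets (vimage_algebra (space P) (\<lambda>\<omega>. - L t \<omega> - - L s \<omega>) borel)
      = sets (vimage_algebra (space P) (\<lambda>\<omega>. L t \<omega> - L s \<omega>) borel)" for s t
  proof -
    have m: "uminus -` A \<in> sets borel" if "A \<in> sets borel" for A :: "real set"
      using measurable_sets_borel[of "uminus :: real \<Rightarrow> real" borel A] that by simp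
    have e1: "(\<lambda>\<omega>. - L t \<omega> - - L s \<omega>) -` A \<inter> space P = (\<lambda>\<omega>. L t \<omega> - L s \<omega>) -` (uminus -` A) \<inter> space P" for A
      by (simp add: vimage_def)
    have e2: "(\<lambda>\<omega>. L t \<omega> - L s \<omega>) -` A \<inter> space P = (\<lambda>\<omega>. - L t \<omega> - - L s \<omega>) -` (uminus -` A) \<inter> space P" for A
      by (simp add: vimage_def)
    have "{(\<lambda>\<omega>. - L t \<omega> - - L s \<omega>) -` A \<inter> space P |A. A \<in> sets borel}
        = {(\<lambda>\<omega>. L t \<omega> - L s \<omega>) -` A \<inter> space P |A. A \<in> sets borel}"
    proof (intro equalityI subsetI; elim CollectE exE conjE)
      fix B A assume "B = (\<lambda>\<omega>. - L t \<omega> - - L s \<omega>) -` A \<inter> space P" "A \<in> sets borel"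
      then have "B = (\<lambda>\<omega>. L t \<omega> - L s \<omega>) -` (uminus -` A) \<inter> space P \<and> uminus -` A \<in> sets borel"
        by (simp only: e1 m simp_thms)
      then show "B \<in> {(\<lambda>\<omega>. L t \<omega> - L s \<omega>) -` A \<inter> space P |A. A \<in> sets borel}"
        by (intro CollectI exI)
    next
      fix B A assume "B = (\<lambda>\<omega>. L t \<omega> - L s \<omega>) -` A \<inter> space P" "A \<in> sets borel"
      then have "B = (\<lambda>\<omega>. - L t \<omega> - - L s \<omega>) -` (uminus -` A) \<inter> space P \<and> uminus -` A \<in> sets borel"
        by (simp only: e2 m simp_thms)
      then show "B \<in> {(\<lambda>\<omega>. - L t \<omega> - - L s \<omega>) -` A \<inter> space P |A. A \<in> sets borel}"
        by (intro CollectI exI)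
    qed
    then show ?thesis by (simp add: sets_vimage_algebra)
  qed
  have C: "cadlag_on T (\<lambda>t. - L t \<omega>)" if "cadlag_on T (\<lambda>t. L t \<omega>)" for \<omega>
    unfolding cadlag_on_def
  proof (intro conjI ballI)
    fix t assume "t \<in> {0..<T}"
    then have "continuous (at_right t) (\<lambda>t. L t \<omega>)" using that unfolding cadlag_on_def by blast
    then show "continuous (at_right t) (\<lambda>t. - L t \<omega>)" by (rule continuous_minus)
  next
    fix t assume "t \<in> {0<..T}"
    then obtain l where "((\<lambda>t. L t \<omega>) \<longlongrightarrow> l) (at_left t)" using \<open>cadlag_on T (\<lambda>t. L t \<omega>)\<close> unfolding cadlag_on_def by blast
    then have "((\<lambda>t. - L t \<omega>) \<longlongrightarrow> - l) (at_left t)" by (rule tendsto_minus)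
    then show "\<exists>l. ((\<lambda>t. - L t \<omega>) \<longlongrightarrow> l) (at_left t)" by blast
  qed
  show ?thesis
    unfolding levy_process_def
  proof (intro conjI)
    show "\<forall>t\<in>{0..T}. (\<lambda>\<omega>. - L t \<omega>) \<in> borel_measurable (F t)"
      using L_ad by simp
    show "\<forall>\<omega>\<in>space P. - L 0 \<omega> = 0" using L_0 by simp
    show "\<forall>\<omega>\<in>space P. cadlag_on T (\<lambda>t. - L t \<omega>)" using L_cad C by blast
  next
    show "\<forall>s t h. 0 \<le> s \<and> 0 \<le> t \<and> 0 \<le> h \<and> s + h \<le> T \<and> t + h \<le> T \<longrightarrow>
        distr P borel (\<lambda>\<omega>. - L (s + h) \<omega> - - L s \<omega>) = distr P borel (\<lambda>\<omega>. - L (t + h) \<omega> - - L t \<omega>)"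
      using A by blast
    show "\<forall>s t. 0 \<le> s \<and> s \<le> t \<and> t \<le> T \<longrightarrow>
        prob_space.indep_set P
          (sets (vimage_algebra (space P) (\<lambda>\<omega>. - L t \<omega> - - L s \<omega>) borel)) (sets (F s))"
      unfolding B by (rule L_ind)
  qed
qed

context levy_on_horizon
begin

lemma grid_telescope: "\<omega> \<in> space P \<Longrightarrow> L (grid T m k) \<omega> = (\<Sum>i<k. incr m i \<omega>)"
  by (induction k) (auto simp: L_0)

text \<open>If one grid increment were negative with probability \<open>p > 0\<close>, then all \<open>m\<close> of them would be negative
  with probability \<open>p^m > 0\<close>, and with them \<open>L T\<close>.  Hence almost surely the path increases along
  all grids, and by right-continuity everywhere.\<close>
lemma subordinator_if_AE_nonneg:
  assumes nn: "AE \<omega> in P. 0 \<le> L T \<omega>"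
  shows "subordinator P F T L"
proof -
  define h :: "real \<Rightarrow> ennreal" where "h = indicator {..<0}"
  have h: "h \<in> borel_measurable borel" unfolding h_def by measurable
  have step: "AE \<omega> in P. 0 \<le> incr m i \<omega>" if i: "i < m" for m i
  proof -
    have m: "0 < m" using i by simp
    have "(\<integral>\<^sup>+\<omega>. h (L (T / real m) \<omega>) \<partial>P) ^ m = (\<integral>\<^sup>+\<omega>. (\<Prod>i<m. h (incr m i \<omega>)) \<partial>P)"
      by (rule grid_product[OF m h order_refl, symmetric])
    also have "\<dots> = (\<integral>\<^sup>+\<omega>. 0 \<partial>P)"
    proof (rule nn_integral_cong_AE)
      show "AE \<omega> in P. (\<Prod>i<m. h (incr m i \<omega>)) = 0"
        using nn AE_space
      proof eventually_elim
        case (elim \<omega>)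
        have "\<exists>i<m. 0 \<le> incr m i \<omega>"
        proof (rule ccontr)
          assume "\<not> ?thesis"
          then have "(\<Sum>i<m. incr m i \<omega>) < 0"
            using m sum_strict_mono[of "{..<m}" "\<lambda>i. incr m i \<omega>" "\<lambda>_. 0"] by (auto simp: not_le)
          then show False using elim grid_telescope[of \<omega> m m] m by simp
        qed
        then obtain i where "i < m" "0 \<le> incr m i \<omega>" by blast
        then show ?case by (intro prod_zero) (auto simp: h_def intro!: bexI[of _ i])
      qed
    qed
    finally have "(\<integral>\<^sup>+\<omega>. h (L (T / real m) \<omega>) \<partial>P) = 0" using m by simp
    moreover have "(\<integral>\<^sup>+\<omega>. h (incr m i \<omega>) \<partial>P) = (\<integral>\<^sup>+\<omega>. h (L (T / real m) \<omega>) \<partial>P)"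
      using increment_stationary[OF _ _ _ h, of "grid T m i" "grid T m (Suc i)"] i
        grid_mono[of T i "Suc i" m] grid_le_horizon[of T "Suc i" m] by (simp add: grid_Suc)
    ultimately have "(\<integral>\<^sup>+\<omega>. h (incr m i \<omega>) \<partial>P) = 0" by simp
    moreover have "incr m i \<in> borel_measurable P"
      using i by (intro borel_measurable_diff L_measurable grid_le_horizon grid_nonneg) auto
    then have "(\<lambda>\<omega>. h (incr m i \<omega>)) \<in> borel_measurable P" by (rule measurable_compose[OF _ h])
    ultimately have "AE \<omega> in P. h (incr m i \<omega>) = 0"
      by (simp only: nn_integral_0_iff_AE)
    then show ?thesis by eventually_elim (auto simp: h_def indicator_def split: if_splits)
  qed
  have "AE \<omega> in P. \<forall>m i. i < m \<longrightarrow> 0 \<le> incr m i \<omega>"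
    unfolding AE_all_countable by (intro allI, rule AE_impI, rule step)
  then have "AE \<omega> in P. mono_on {0..T} (\<lambda>t. L t \<omega>)"
    using AE_space
  proof eventually_elim
    case (elim \<omega>)
    show ?case
    proof (rule mono_onI)
      fix s t assume st: "s \<in> {0..T}" "t \<in> {0..T}" "s \<le> t"
      have grid_mon: "L (grid T m i) \<omega> \<le> L (grid T m j) \<omega>" if "i \<le> j" "j \<le> m" for i j m
        using that
      proof (induction rule: dec_induct)
        case (step n)
        then have "n < m" by simp
        with elim(1) have "0 \<le> incr m n \<omega>" by blast
        moreover have "L (grid T m i) \<omega> \<le> L (grid T m n) \<omega>" using step by simp
        ultimately show ?case by linarith
      qed simp
      have cad: "cadlag_on T (\<lambda>t. L t \<omega>)" using elim L_cadlag by simp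
      show "L s \<omega> \<le> L t \<omega>"
      proof (rule tendsto_le[OF _ cadlag_grid_tendsto[OF cad horizon_pos st(2)] cadlag_grid_tendsto[OF cad horizon_pos st(1)]])
        show "eventually (\<lambda>m. L (grid T m (next_ix T m s)) \<omega> \<le> L (grid T m (next_ix T m t)) \<omega>) sequentially"
          using eventually_gt_at_top[of 0]
        proof eventually_elim
          case (elim m)
          then show ?case using st horizon_pos by (intro grid_mon next_ix_mono next_ix_le) auto
        qed
      qed simp
    qed
  qed
  then show ?thesis using levy by (simp add: subordinator_def)
qed

lemma pos_part_if_not_subordinator:
  assumes "\<not> subordinator P F T (\<lambda>t \<omega>. - L t \<omega>)"
  shows "\<not> (AE \<omega> in P. L T \<omega> \<le> 0)"
proof
  assume "AE \<omega> in P. L T \<omega> \<le> 0"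
  interpret neg: levy_on_horizon P F T "\<lambda>t \<omega>. - L t \<omega>"
    by (rule levy_on_horizon.intro[OF prob_space_axioms levy_on_horizon_axioms.intro[OF
          horizon_pos filtr subalg levy_process_uminus[OF prob_space_axioms subalg levy]]])
  have "subordinator P F T (\<lambda>t \<omega>. - L t \<omega>)"
    by (rule neg.subordinator_if_AE_nonneg) (use \<open>AE \<omega> in P. L T \<omega> \<le> 0\<close> in auto)
  then show False using assms by simp
qed

section \<open>Exponentials of stopped Levy processes\<close>

lemma exp_L_nn_integral_grid:
  assumes "0 < m" "k \<le> m"
  shows "(\<integral>\<^sup>+\<omega>. ennreal (exp (\<kappa> * L (grid T m k) \<omega>)) \<partial>P)
    = (\<integral>\<^sup>+\<omega>. ennreal (exp (\<kappa> * L (T / real m) \<omega>)) \<partial>P) ^ k"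
proof -
  have h: "(\<lambda>x. ennreal (exp (\<kappa> * x))) \<in> borel_measurable borel" by measurable
  have "(\<integral>\<^sup>+\<omega>. ennreal (exp (\<kappa> * L (grid T m k) \<omega>)) \<partial>P)
      = (\<integral>\<^sup>+\<omega>. (\<Prod>i<k. ennreal (exp (\<kappa> * incr m i \<omega>))) \<partial>P)"
  proof (intro nn_integral_cong)
    fix \<omega> assume \<omega>: "\<omega> \<in> space P"
    have "\<kappa> * L (grid T m k) \<omega> = (\<Sum>i<k. \<kappa> * incr m i \<omega>)"
      unfolding sum_distrib_left[symmetric] by (rule arg_cong[OF grid_telescope[OF \<omega>]])
    then show "ennreal (exp (\<kappa> * L (grid T m k) \<omega>)) = (\<Prod>i<k. ennreal (exp (\<kappa> * incr m i \<omega>)))"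
      by (simp only: exp_sum[OF finite_lessThan] prod_ennreal exp_ge_zero)
  qed
  also have "\<dots> = (\<integral>\<^sup>+\<omega>. ennreal (exp (\<kappa> * L (T / real m) \<omega>)) \<partial>P) ^ k"
    by (rule grid_product[OF assms(1) h assms(2)])
  finally show ?thesis .
qed

text \<open>The moment generating function of \<open>L\<close> at a grid time is a power of the one for a single step.  Since
  the \<open>m\<close>-th power is at most \<open>1\<close>, smaller powers dominate it.\<close>
lemma mgf_le_mgf_remaining:
  assumes m: "0 < m" "k \<le> m" and le1: "mgf P T L \<kappa> \<le> 1"
  shows "mgf P T L \<kappa> \<le> (\<integral>\<^sup>+\<omega>. ennreal (exp (\<kappa> * L (T - grid T m k) \<omega>)) \<partial>P)"
proof -
  let ?a = "\<integral>\<^sup>+\<omega>. ennreal (exp (\<kappa> * L (T / real m) \<omega>)) \<partial>P"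
  have eq: "T - grid T m k = grid T m (m - k)"
    using m by (simp add: grid_def of_nat_diff field_simps)
  have am: "?a ^ m = mgf P T L \<kappa>"
    using exp_L_nn_integral_grid[of m m \<kappa>] m by (simp add: mgf_def)
  have "?a \<noteq> \<infinity>" using am le1 m by (auto simp: top_power_ennreal top_unique)
  then obtain r where r: "?a = ennreal r" "0 \<le> r" by (cases ?a) auto
  have "ennreal (r ^ m) = mgf P T L \<kappa>" using am r by (simp add: ennreal_power)
  then have rm: "r ^ m \<le> 1" using le1 r(2) by (metis ennreal_1 ennreal_le_iff zero_le_one)
  then have r1: "r \<le> 1" using m r(2) by (simp add: power_le_one_iff)
  have "mgf P T L \<kappa> = ennreal (r ^ m)" using am r by (simp add: ennreal_power)
  also have "\<dots> \<le> ennreal (r ^ (m - k))"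
    using r r1 by (intro ennreal_leI power_decreasing) auto
  also have "\<dots> = (\<integral>\<^sup>+\<omega>. ennreal (exp (\<kappa> * L (grid T m (m - k)) \<omega>)) \<partial>P)"
    using exp_L_nn_integral_grid[of m "m - k" \<kappa>] m r by (simp add: ennreal_power)
  finally show ?thesis by (simp add: eq)
qed

text \<open>Factor \<open>exp (\<kappa> L T)\<close> into its value at the grid time and an independent factor, whose
  expectation the previous lemma bounds from below.  This is the martingale property of
  \<open>exp (\<kappa> L t) / E exp (\<kappa> L t)\<close> with the ratio of the two normalising constants replaced by a bound.\<close>
lemma exp_L_le_terminal_on_grid:
  assumes m: "0 < m" "k \<le> m" and le1: "mgf P T L \<kappa> \<le> 1" and A: "A \<in> sets (F (grid T m k))"
  shows "mgf P T L \<kappa> * (\<integral>\<^sup>+\<omega>. ennreal (exp (\<kappa> * L (grid T m k) \<omega>)) * indicator A \<omega> \<partial>P)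
    \<le> (\<integral>\<^sup>+\<omega>. ennreal (exp (\<kappa> * L T \<omega>)) * indicator A \<omega> \<partial>P)"
proof -
  let ?g = "grid T m k"
  let ?V = "\<lambda>\<omega>. ennreal (exp (\<kappa> * L ?g \<omega>)) * indicator A \<omega>"
  have g: "0 \<le> ?g" "?g \<le> T" using m by (auto intro!: grid_le_horizon)
  have h: "(\<lambda>x. ennreal (exp (\<kappa> * x))) \<in> borel_measurable borel" by measurable
  have [measurable]: "L ?g \<in> borel_measurable (F ?g)" using L_adapted[of ?g ?g] g by simp
  have V: "?V \<in> borel_measurable (F ?g)" using A by measurable
  have "mgf P T L \<kappa> * (\<integral>\<^sup>+\<omega>. ?V \<omega> \<partial>P)
      \<le> (\<integral>\<^sup>+\<omega>. ennreal (exp (\<kappa> * L (T - ?g) \<omega>)) \<partial>P) * (\<integral>\<^sup>+\<omega>. ?V \<omega> \<partial>P)"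
    by (rule mult_right_mono[OF mgf_le_mgf_remaining[OF m le1]]) simp
  also have "\<dots> = (\<integral>\<^sup>+\<omega>. ennreal (exp (\<kappa> * (L T \<omega> - L ?g \<omega>))) * ?V \<omega> \<partial>P)"
    using increment_indep[OF g(1) g(2) order_refl h V] by simp
  also have "\<dots> = (\<integral>\<^sup>+\<omega>. ennreal (exp (\<kappa> * L T \<omega>)) * indicator A \<omega> \<partial>P)"
    by (intro nn_integral_cong)
       (auto simp: indicator_def ennreal_mult[symmetric] exp_add[symmetric] algebra_simps)
  finally show ?thesis .
qed

text \<open>Where \<open>\<tau> < T\<close>, replace \<open>\<tau>\<close> by the next grid point and decompose according to its index.  Each
  piece is controlled by the previous lemma, the pieces add up to the event \<open>\<tau> < T\<close>, and
  right-continuity with Fatou's lemma gives the limit of fine grids.\<close>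
lemma stopped_exp_bound:
  assumes le1: "mgf P T L \<kappa> \<le> 1"
    and st: "stopping_time (extend_horizon T F) \<tau>" and \<tau>0: "\<And>\<omega>. \<omega> \<in> space P \<Longrightarrow> 0 \<le> \<tau> \<omega>"
    and X [measurable]: "(\<lambda>\<omega>. L (min (\<tau> \<omega>) T) \<omega>) \<in> borel_measurable P"
  shows "mgf P T L \<kappa> * (\<integral>\<^sup>+\<omega>. ennreal (exp (\<kappa> * L (min (\<tau> \<omega>) T) \<omega>)) \<partial>P)
    \<le> mgf P T L \<kappa> * mgf P T L \<kappa> + (\<integral>\<^sup>+\<omega>. ennreal (exp (\<kappa> * L T \<omega>)) * indicator {\<omega>\<in>space P. \<tau> \<omega> < T} \<omega> \<partial>P)"
proof -
  have \<tau>_le: "{\<omega>\<in>space P. \<tau> \<omega> \<le> t} \<in> sets (F t)" if "0 \<le> t" "t \<le> T" for t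
  proof -
    have "Measurable.pred (F t) (\<lambda>\<omega>. \<tau> \<omega> \<le> t)"
      using st[unfolded stopping_time_def, rule_format, of t] that by (simp add: extend_horizon_def)
    then show ?thesis using that by (simp add: pred_def)
  qed
  have \<tau>_less: "{\<omega>\<in>space P. \<tau> \<omega> < T} \<in> sets (F T)"
  proof -
    have "Measurable.pred (F T) (\<lambda>\<omega>. \<tau> \<omega> < T)"
      using filtration.stopping_time_less_const[OF filtr st, of T] by (simp add: extend_horizon_def)
    then show ?thesis by (simp add: pred_def)
  qed
  define A where "A m i = {\<omega>\<in>space P. \<tau> \<omega> < T \<and> next_ix T m (\<tau> \<omega>) = i}" for m i
  \<comment> \<open>At the last index, where \<open>grid T m i = T\<close>, the strict inequality \<open>\<tau> < T\<close> decides about the event.\<close>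
  have A: "A m i \<in> sets (F (grid T m i))" if m: "0 < m" "i \<le> m" for m i
  proof -
    have g: "0 \<le> grid T m i" "grid T m i \<le> T" using m by (auto intro!: grid_le_horizon)
    have le: "{\<omega>\<in>space P. \<tau> \<omega> < T \<and> next_ix T m (\<tau> \<omega>) \<le> i} \<in> sets (F (grid T m i))"
    proof (cases "i = m")
      case True
      have "{\<omega>\<in>space P. \<tau> \<omega> < T \<and> next_ix T m (\<tau> \<omega>) \<le> i} = {\<omega>\<in>space P. \<tau> \<omega> < T}"
        using True m horizon_pos by (auto simp: next_ix_le_iff)
      then show ?thesis using \<tau>_less True m by simp
    next
      case False
      then have "grid T m i < T" using m horizon_pos by (simp add: grid_def field_simps)
      then have "{\<omega>\<in>space P. \<tau> \<omega> < T \<and> next_ix T m (\<tau> \<omega>) \<le> i} = {\<omega>\<in>space P. \<tau> \<omega> \<le> grid T m i}"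
        using m horizon_pos by (auto simp: next_ix_le_iff)
      then show ?thesis using \<tau>_le[OF g] by simp
    qed
    show ?thesis
    proof (cases i)
      case 0
      then show ?thesis using le by (simp add: A_def)
    next
      case (Suc j)
      have gj: "0 \<le> grid T m j" "grid T m j \<le> grid T m i" using Suc by (auto intro!: grid_mono)
      have "{\<omega>\<in>space P. \<tau> \<omega> \<le> grid T m j} \<in> sets (F (grid T m i))"
        using \<tau>_le[of "grid T m j"] sets_F_mono[OF gj g(2)] gj g by auto
      then have "{\<omega>\<in>space P. \<tau> \<omega> < T \<and> next_ix T m (\<tau> \<omega>) \<le> i} - {\<omega>\<in>space P. \<tau> \<omega> \<le> grid T m j} \<in> sets (F (grid T m i))"
        using le by blast
      moreover have "{\<omega>\<in>space P. \<tau> \<omega> < T \<and> next_ix T m (\<tau> \<omega>) \<le> i} - {\<omega>\<in>space P. \<tau> \<omega> \<le> grid T m j} = A m i"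
        using Suc m horizon_pos by (auto simp: A_def next_ix_le_iff[symmetric])
      ultimately show ?thesis by simp
    qed
  qed
  have A_P: "A m i \<in> events" if "0 < m" "i \<le> m" for m i
    using A[OF that] subalg[of "grid T m i"] grid_le_horizon[of T i m] that by (auto simp: subalgebra_def)
  have less_P: "{\<omega>\<in>space P. \<tau> \<omega> < T} \<in> events"
    using \<tau>_less subalg[of T] by (auto simp: subalgebra_def)
  obtain c where c: "mgf P T L \<kappa> = ennreal c" "0 \<le> c"
    using le1 by (cases "mgf P T L \<kappa>") (auto simp: top_unique)
  let ?e = "\<lambda>t \<omega>. ennreal (exp (\<kappa> * L t \<omega>))"
  have e_meas [measurable]: "?e t \<in> borel_measurable P" if "0 \<le> t" "t \<le> T" for t
    using L_measurable[OF that] by measurable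
  have eT [measurable]: "?e T \<in> borel_measurable P" by (rule e_meas) auto
  let ?D = "{\<omega>\<in>space P. \<tau> \<omega> < T}"
  define U where "U m \<omega> = ennreal c * (?e T \<omega> * indicator (space P - ?D) \<omega> + (\<Sum>i\<le>m. ?e (grid T m i) \<omega> * indicator (A m i) \<omega>))" for m \<omega>
  have U_meas: "U m \<in> borel_measurable P" if "0 < m" for m
    unfolding U_def using that less_P A_P
    by (intro borel_measurable_times_ennreal borel_measurable_add borel_measurable_sum borel_measurable_const
        e_meas borel_measurable_indicator grid_le_horizon grid_nonneg) auto
  have U_eq: "U m \<omega> = ennreal (c * exp (\<kappa> * L (grid T m (next_ix T m (min (\<tau> \<omega>) T))) \<omega>))"
    if m: "0 < m" and \<omega>: "\<omega> \<in> space P" for m \<omega>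
  proof (cases "\<tau> \<omega> < T")
    case True
    have ix: "next_ix T m (\<tau> \<omega>) \<le> m" using True m horizon_pos \<tau>0[OF \<omega>] by (intro next_ix_le) auto
    have "(\<Sum>i\<le>m. ?e (grid T m i) \<omega> * indicator (A m i) \<omega>)
        = (\<Sum>i\<in>{next_ix T m (\<tau> \<omega>)}. ?e (grid T m i) \<omega> * indicator (A m i) \<omega>)"
      by (rule sum.mono_neutral_right) (use ix in \<open>auto simp: A_def\<close>)
    also have "\<dots> = ?e (grid T m (next_ix T m (\<tau> \<omega>))) \<omega>" using True \<omega> by (simp add: A_def)
    finally show ?thesis using True \<omega> c(2) by (simp add: U_def ennreal_mult min_def)
  next
    case False
    then have "(\<Sum>i\<le>m. ?e (grid T m i) \<omega> * indicator (A m i) \<omega>) = 0" by (simp add: A_def)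
    moreover have "grid T m (next_ix T m T) = T" using m horizon_pos by (simp add: next_ix_def)
    ultimately show ?thesis using False \<omega> c(2) by (simp add: U_def ennreal_mult min_def)
  qed
  have U_lim: "(\<lambda>m. U (Suc m) \<omega>) \<longlonglongrightarrow> ennreal (c * exp (\<kappa> * L (min (\<tau> \<omega>) T) \<omega>))" if \<omega>: "\<omega> \<in> space P" for \<omega>
  proof -
    have "(\<lambda>m. L (grid T m (next_ix T m (min (\<tau> \<omega>) T))) \<omega>) \<longlonglongrightarrow> L (min (\<tau> \<omega>) T) \<omega>"
      by (rule cadlag_grid_tendsto[OF L_cadlag[OF \<omega>] horizon_pos]) (use \<tau>0[OF \<omega>] in auto)
    then have "(\<lambda>m. ennreal (c * exp (\<kappa> * L (grid T m (next_ix T m (min (\<tau> \<omega>) T))) \<omega>))) \<longlonglongrightarrow> ennreal (c * exp (\<kappa> * L (min (\<tau> \<omega>) T) \<omega>))"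
      by (intro tendsto_ennrealI tendsto_intros)
    from LIMSEQ_Suc[OF this] show ?thesis using U_eq[OF _ \<omega>] by simp
  qed
  have U_int: "(\<integral>\<^sup>+\<omega>. U m \<omega> \<partial>P) \<le> mgf P T L \<kappa> * mgf P T L \<kappa> + (\<integral>\<^sup>+\<omega>. ?e T \<omega> * indicator ?D \<omega> \<partial>P)"
    if m: "0 < m" for m
  proof -
    have t1: "(\<integral>\<^sup>+\<omega>. ?e T \<omega> * indicator (space P - ?D) \<omega> \<partial>P) \<le> mgf P T L \<kappa>"
      unfolding mgf_def by (intro nn_integral_mono) (auto simp: indicator_def)
    have s_meas: "(\<lambda>\<omega>. ?e (grid T m i) \<omega> * indicator (A m i) \<omega>) \<in> borel_measurable P" if "i \<le> m" for i
      using that m A_P by (intro borel_measurable_times_ennreal e_meas borel_measurable_indicator grid_le_horizon grid_nonneg) auto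
    have t2: "(\<integral>\<^sup>+\<omega>. (\<Sum>i\<le>m. ?e (grid T m i) \<omega> * indicator (A m i) \<omega>) \<partial>P)
        = (\<Sum>i\<le>m. \<integral>\<^sup>+\<omega>. ?e (grid T m i) \<omega> * indicator (A m i) \<omega> \<partial>P)"
      by (rule nn_integral_sum) (use s_meas in auto)
    have "mgf P T L \<kappa> * (\<Sum>i\<le>m. \<integral>\<^sup>+\<omega>. ?e (grid T m i) \<omega> * indicator (A m i) \<omega> \<partial>P)
        \<le> (\<Sum>i\<le>m. \<integral>\<^sup>+\<omega>. ?e T \<omega> * indicator (A m i) \<omega> \<partial>P)"
      unfolding sum_distrib_left
      by (intro sum_mono exp_L_le_terminal_on_grid le1 A m) auto
    also have "\<dots> = (\<integral>\<^sup>+\<omega>. (\<Sum>i\<le>m. ?e T \<omega> * indicator (A m i) \<omega>) \<partial>P)"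
      by (rule nn_integral_sum[symmetric]) (use m A_P eT in auto)
    also have "\<dots> \<le> (\<integral>\<^sup>+\<omega>. ?e T \<omega> * indicator ?D \<omega> \<partial>P)"
    proof (intro nn_integral_mono)
      fix \<omega> assume "\<omega> \<in> space P"
      have "(\<Sum>i\<le>m. indicator (A m i) \<omega> :: ennreal) = (\<Sum>i\<in>{..m} \<inter> {next_ix T m (\<tau> \<omega>)}. indicator (A m i) \<omega>)"
        by (rule sum.mono_neutral_right) (auto simp: A_def indicator_def split: if_splits)
      also have "\<dots> \<le> indicator ?D \<omega>" by (auto simp: A_def indicator_def Int_insert_right)
      finally show "(\<Sum>i\<le>m. ?e T \<omega> * indicator (A m i) \<omega>) \<le> ?e T \<omega> * indicator ?D \<omega>"
        by (simp add: sum_distrib_left[symmetric] mult_left_mono)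
    qed
    finally have t3: "mgf P T L \<kappa> * (\<Sum>i\<le>m. \<integral>\<^sup>+\<omega>. ?e (grid T m i) \<omega> * indicator (A m i) \<omega> \<partial>P)
        \<le> (\<integral>\<^sup>+\<omega>. ?e T \<omega> * indicator ?D \<omega> \<partial>P)" .
    have mS: "(\<lambda>\<omega>. \<Sum>i\<le>m. ?e (grid T m i) \<omega> * indicator (A m i) \<omega>) \<in> borel_measurable P"
      by (intro borel_measurable_sum s_meas) simp
    have mT: "(\<lambda>\<omega>. ?e T \<omega> * indicator (space P - ?D) \<omega>) \<in> borel_measurable P"
      using less_P by (intro borel_measurable_times_ennreal eT borel_measurable_indicator sets.compl_sets)
    have "(\<integral>\<^sup>+\<omega>. U m \<omega> \<partial>P) = mgf P T L \<kappa> * ((\<integral>\<^sup>+\<omega>. ?e T \<omega> * indicator (space P - ?D) \<omega> \<partial>P)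
        + (\<Sum>i\<le>m. \<integral>\<^sup>+\<omega>. ?e (grid T m i) \<omega> * indicator (A m i) \<omega> \<partial>P))"
      unfolding U_def c(1) t2[symmetric]
      by (simp only: nn_integral_cmult[OF borel_measurable_add[OF mT mS]] nn_integral_add[OF mT mS])
    then show ?thesis
      unfolding distrib_left using add_mono[OF mult_left_mono[OF t1] t3] by simp
  qed
  have "mgf P T L \<kappa> * (\<integral>\<^sup>+\<omega>. ?e (min (\<tau> \<omega>) T) \<omega> \<partial>P) \<le> (\<integral>\<^sup>+\<omega>. liminf (\<lambda>m. U (Suc m) \<omega>) \<partial>P)"
  proof -
    have lim: "liminf (\<lambda>m. U (Suc m) \<omega>) = ennreal c * ?e (min (\<tau> \<omega>) T) \<omega>" if "\<omega> \<in> space P" for \<omega>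
      using lim_imp_Liminf[OF _ U_lim[OF that]] c(2) by (simp add: ennreal_mult)
    show ?thesis unfolding c(1)
      by (subst nn_integral_cmult[symmetric]) (auto simp: lim intro!: nn_integral_mono)
  qed
  also have "\<dots> \<le> liminf (\<lambda>m. \<integral>\<^sup>+\<omega>. U (Suc m) \<omega> \<partial>P)"
    by (intro nn_integral_liminf U_meas) auto
  also have "\<dots> \<le> mgf P T L \<kappa> * mgf P T L \<kappa> + (\<integral>\<^sup>+\<omega>. ?e T \<omega> * indicator ?D \<omega> \<partial>P)"
    by (intro Liminf_le always_eventually allI U_int) auto
  finally show ?thesis .
qed

end

section \<open>Minima of damped moment generating functions\<close>

text \<open>The minima increase and stay below \<open>\<phi> \<kappa>\<^sub>0 \<le> 1\<close>.  Since \<open>X\<close> takes both signs, the damped functions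
  are coercive, so a subsequence of the minimisers converges to some \<open>q\<close>.  For fixed \<open>m\<close> Fatou's lemma
  bounds \<open>\<Phi> m q\<close> by the limit of the minima, and \<open>m \<longlonglongrightarrow> \<infinity>\<close> bounds
  \<open>\<phi> q \<ge> \<phi> \<kappa>\<^sub>0\<close> by it.\<close>
lemma (in prob_space) damped_mgf_minimum_tendsto:
  fixes X S :: "'a \<Rightarrow> real" and k :: "nat \<Rightarrow> real"
  defines "\<Phi> \<equiv> \<lambda>n \<kappa>. \<integral>\<^sup>+\<omega>. ennreal (exp (\<kappa> * X \<omega> - S \<omega> / real n)) \<partial>M"
    and "\<phi> \<equiv> \<lambda>\<kappa>. \<integral>\<^sup>+\<omega>. ennreal (exp (\<kappa> * X \<omega>)) \<partial>M"
  assumes X [measurable]: "X \<in> borel_measurable M" and S [measurable]: "S \<in> borel_measurable M"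
    and S_nonneg: "\<And>\<omega>. 0 \<le> S \<omega>"
    and k_min: "\<And>n \<kappa>. 1 \<le> n \<Longrightarrow> \<Phi> n (k n) \<le> \<Phi> n \<kappa>"
    and \<kappa>\<^sub>0_min: "\<And>\<kappa>. \<phi> \<kappa>\<^sub>0 \<le> \<phi> \<kappa>"
    and pos: "\<not> (AE \<omega> in M. X \<omega> \<le> 0)" and neg: "\<not> (AE \<omega> in M. 0 \<le> X \<omega>)"
  shows "(\<lambda>n. \<Phi> n (k n)) \<longlonglongrightarrow> \<phi> \<kappa>\<^sub>0"
proof -
  define \<Psi> where "\<Psi> n = \<Phi> (Suc n)" for n
  define l where "l n = k (Suc n)" for n
  define v where "v n = \<Psi> n (l n)" for n
  have l_min: "v n \<le> \<Psi> n \<kappa>" for n \<kappa>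
    unfolding v_def \<Psi>_def l_def by (rule k_min) simp
  have damp: "S \<omega> / real (Suc n) \<le> S \<omega> / real (Suc m)" if "m \<le> n" for \<omega> m n
    using that S_nonneg[of \<omega>] by (intro divide_left_mono) auto
  have \<Psi>_mono: "\<Psi> m \<kappa> \<le> \<Psi> n \<kappa>" if "m \<le> n" for m n \<kappa>
    unfolding \<Psi>_def \<Phi>_def using damp[OF that] by (intro nn_integral_mono ennreal_leI) simp
  have \<phi>_SUP: "\<phi> \<kappa> = (SUP n. \<Psi> n \<kappa>)" for \<kappa>
  proof -
    let ?f = "\<lambda>n \<omega>. ennreal (exp (\<kappa> * X \<omega> - S \<omega> / real (Suc n)))"
    have inc: "incseq (\<lambda>n. ?f n \<omega>)" for \<omega>
    proof (intro incseq_SucI ennreal_leI)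
      fix n
      show "exp (\<kappa> * X \<omega> - S \<omega> / real (Suc n)) \<le> exp (\<kappa> * X \<omega> - S \<omega> / real (Suc (Suc n)))"
        using damp[of n "Suc n" \<omega>] by simp
    qed
    have "(\<lambda>n. ?f n \<omega>) \<longlonglongrightarrow> ennreal (exp (\<kappa> * X \<omega>))" for \<omega>
    proof -
      have "(\<lambda>n. exp (\<kappa> * X \<omega> - S \<omega> / real (Suc n))) \<longlonglongrightarrow> exp (\<kappa> * X \<omega> - 0)"
        by (intro tendsto_intros LIMSEQ_Suc[OF lim_const_over_n])
      then show ?thesis by (intro tendsto_ennrealI) simp
    qed
    then have "(SUP n. ?f n \<omega>) = ennreal (exp (\<kappa> * X \<omega>))" for \<omega>
      using LIMSEQ_SUP[OF inc] LIMSEQ_unique by blast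
    then have "\<phi> \<kappa> = (\<integral>\<^sup>+\<omega>. (SUP n. ?f n \<omega>) \<partial>M)" by (simp add: \<phi>_def)
    also have "\<dots> = (SUP n. integral\<^sup>N M (?f n))"
      by (rule nn_integral_monotone_convergence_SUP) (use inc in \<open>auto simp: incseq_def le_fun_def\<close>)
    finally show ?thesis by (simp add: \<Psi>_def \<Phi>_def)
  qed
  have \<Psi>_le: "\<Psi> n \<kappa> \<le> \<phi> \<kappa>" for n \<kappa> unfolding \<phi>_SUP by (rule SUP_upper) simp
  have "incseq v"
  proof (rule incseq_SucI)
    fix n
    show "v n \<le> v (Suc n)"
      using l_min[of n "l (Suc n)"] \<Psi>_mono[of n "Suc n" "l (Suc n)"] by (simp add: v_def)
  qed
  have v_le: "v n \<le> \<phi> \<kappa>\<^sub>0" for n using l_min[of n \<kappa>\<^sub>0] \<Psi>_le[of n \<kappa>\<^sub>0] by (rule order_trans)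
  have "\<phi> \<kappa>\<^sub>0 \<le> \<phi> 0" by (rule \<kappa>\<^sub>0_min)
  also have "\<phi> 0 = 1" by (simp add: \<phi>_def emeasure_space_1)
  finally have \<phi>_le1: "\<phi> \<kappa>\<^sub>0 \<le> 1" .
  have \<Psi>0: "\<Psi> 0 (l n) \<le> 1" for n
    using \<Psi>_mono[of 0 n "l n"] v_le[of n] \<phi>_le1 by (simp add: v_def)
  \<comment> \<open>One-sided bound on the minimisers, from \<open>exp y \<ge> y\<close>.\<close>
  have bound: "\<exists>B. \<forall>n. s * l n \<le> B" if s: "\<bar>s\<bar> = 1" "\<not> (AE \<omega> in M. s * X \<omega> \<le> 0)" for s
  proof -
    define b where "b = (\<integral>\<^sup>+\<omega>. ennreal (exp (- S \<omega>) * max 0 (s * X \<omega>)) \<partial>M)"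
    have "b \<noteq> 0"
    proof
      assume "b = 0"
      then have "AE \<omega> in M. ennreal (exp (- S \<omega>) * max 0 (s * X \<omega>)) = 0"
        unfolding b_def by (subst (asm) nn_integral_0_iff_AE) auto
      then have "AE \<omega> in M. s * X \<omega> \<le> 0"
      proof eventually_elim
        case (elim \<omega>)
        then have "exp (- S \<omega>) * max 0 (s * X \<omega>) \<le> 0" by (simp only: ennreal_eq_0_iff)
        then have "max 0 (s * X \<omega>) \<le> 0" by (simp only: mult_le_0_iff) (simp add: not_le)
        then show ?case by (simp only: max.bounded_iff)
      qed
      then show False using s by simp
    qed
    have ss: "s * s = 1" using s(1) by (metis abs_mult_self_eq mult_1)
    have le: "ennreal (s * l n) * b \<le> 1" if "0 \<le> s * l n" for n
    proof -
      have "ennreal (s * l n) * b = (\<integral>\<^sup>+\<omega>. ennreal ((s * l n) * (exp (- S \<omega>) * max 0 (s * X \<omega>))) \<partial>M)"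
        unfolding b_def using that by (simp add: nn_integral_cmult[symmetric] ennreal_mult)
      also have "\<dots> \<le> \<Psi> 0 (l n)"
        unfolding \<Psi>_def \<Phi>_def
      proof (intro nn_integral_mono ennreal_leI)
        fix \<omega>
        have "(s * l n) * max 0 (s * X \<omega>) \<le> exp (l n * X \<omega>)"
        proof (cases "0 \<le> s * X \<omega>")
          case True
          have "(s * l n) * (s * X \<omega>) = (s * s) * (l n * X \<omega>)" by simp
          then have "(s * l n) * max 0 (s * X \<omega>) = l n * X \<omega>" using True ss by (simp add: max_absorb2)
          then show ?thesis using exp_ge_add_one_self[of "l n * X \<omega>"] by linarith
        qed (simp add: max_def)
        then have "exp (- S \<omega>) * ((s * l n) * max 0 (s * X \<omega>)) \<le> exp (- S \<omega>) * exp (l n * X \<omega>)"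
          by (rule mult_left_mono) simp
        then show "(s * l n) * (exp (- S \<omega>) * max 0 (s * X \<omega>)) \<le> exp (l n * X \<omega> - S \<omega> / real (Suc 0))"
          by (simp add: exp_diff exp_minus field_simps)
      qed
      also have "\<dots> \<le> 1" by (rule \<Psi>0)
      finally show ?thesis .
    qed
    show ?thesis
    proof (cases b)
      case (real r)
      then have r: "0 < r" using \<open>b \<noteq> 0\<close> by (cases "r = 0") auto
      have "s * l n \<le> 1 / r" for n
      proof (cases "0 \<le> s * l n")
        case True
        then have "ennreal (s * l n * r) \<le> 1" using le[OF True] real by (simp add: ennreal_mult)
        then show ?thesis using r by (simp add: field_simps)
      next
        case False
        moreover have "0 < 1 / r" using r by simp
        ultimately show ?thesis by linarith
      qed
      then show ?thesis by blast
    next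
      case top
      have "s * l n \<le> 0" for n
        using le[of n] top by (cases "s * l n \<le> 0") (auto simp: ennreal_mult_top top_unique ennreal_eq_0_iff)
      then show ?thesis by blast
    qed
  qed
  obtain B1 where B1: "\<And>n. l n \<le> B1" using bound[of 1] pos by auto
  obtain B2 where B2: "\<And>n. - l n \<le> B2" using bound[of "-1"] neg by auto
  have "bounded (range l)"
    unfolding bounded_iff
  proof (intro exI[of _ "max B1 B2"] ballI)
    fix x assume "x \<in> range l"
    then have "x \<le> B1" "- x \<le> B2" using B1 B2 by auto
    then show "norm x \<le> max B1 B2" by simp
  qed
  then obtain q r where r: "strict_mono (r :: nat \<Rightarrow> nat)" "(l \<circ> r) \<longlonglongrightarrow> q"
    using bounded_imp_convergent_subsequence by blast
  have "\<Psi> m q \<le> (SUP n. v n)" for m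
  proof -
    let ?f = "\<lambda>\<kappa> \<omega>. ennreal (exp (\<kappa> * X \<omega> - S \<omega> / real (Suc m)))"
    have lim: "(\<lambda>j. ?f (l (r j)) \<omega>) \<longlonglongrightarrow> ?f q \<omega>" for \<omega>
      using r(2) by (intro tendsto_ennrealI tendsto_intros) (simp add: o_def)
    have "\<Psi> m q = (\<integral>\<^sup>+\<omega>. liminf (\<lambda>j. ?f (l (r j)) \<omega>) \<partial>M)"
      unfolding \<Psi>_def \<Phi>_def using lim_imp_Liminf[OF _ lim] by simp
    also have "\<dots> \<le> liminf (\<lambda>j. integral\<^sup>N M (?f (l (r j))))"
      by (rule nn_integral_liminf) measurable
    also have "\<dots> \<le> (SUP n. v n)"
    proof (rule Liminf_le)
      show "eventually (\<lambda>j. integral\<^sup>N M (?f (l (r j))) \<le> (SUP n. v n)) sequentially"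
        using eventually_ge_at_top[of m]
      proof eventually_elim
        case (elim j)
        then have "m \<le> r j" using seq_suble[OF r(1), of j] by linarith
        then have "\<Psi> m (l (r j)) \<le> v (r j)" unfolding v_def by (rule \<Psi>_mono)
        also have "\<dots> \<le> (SUP n. v n)" by (rule SUP_upper) simp
        finally show ?case by (simp add: \<Psi>_def \<Phi>_def)
      qed
    qed simp
    finally show ?thesis .
  qed
  then have "\<phi> q \<le> (SUP n. v n)" unfolding \<phi>_SUP by (rule SUP_least)
  with \<kappa>\<^sub>0_min[of q] have "\<phi> \<kappa>\<^sub>0 \<le> (SUP n. v n)" by (rule order_trans)
  moreover have "(SUP n. v n) \<le> \<phi> \<kappa>\<^sub>0" by (rule SUP_least) (rule v_le)
  ultimately have "(SUP n. v n) = \<phi> \<kappa>\<^sub>0" by (rule antisym[rotated])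
  then have "v \<longlonglongrightarrow> \<phi> \<kappa>\<^sub>0" using LIMSEQ_SUP[OF \<open>incseq v\<close>] by simp
  then show ?thesis unfolding v_def \<Psi>_def l_def by (rule LIMSEQ_imp_Suc)
qed

section \<open>Relative entropy and exponential moments\<close>

lemma restr_to_subalg_self:
  assumes "sets M = sets G"
  shows "restr_to_subalg M G = M"
proof -
  have sub: "subalgebra M G" using assms sets_eq_imp_space_eq[OF assms] by (simp add: subalgebra_def)
  show ?thesis
  proof (rule measure_eqI)
    show "sets (restr_to_subalg M G) = sets M" using sub assms by (simp add: sets_restr_to_subalg)
    fix A assume "A \<in> sets (restr_to_subalg M G)"
    then have "A \<in> sets G" using sub by (simp add: sets_restr_to_subalg)
    then show "emeasure (restr_to_subalg M G) A = emeasure M A" by (rule emeasure_restr_to_subalg[OF sub])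
  qed
qed

lemma rel_entropy_density:
  assumes sub: "subalgebra R G" and fin: "sigma_finite_measure (restr_to_subalg R G)"
    and f [measurable]: "f \<in> borel_measurable (restr_to_subalg R G)" and f_nonneg: "\<And>\<omega>. 0 \<le> f \<omega>"
    and int: "integrable (restr_to_subalg R G) (\<lambda>\<omega>. f \<omega> * ln (f \<omega>))"
  shows "rel_entropy G (density (restr_to_subalg R G) (\<lambda>\<omega>. ennreal (f \<omega>))) R
    = ereal (\<integral>\<omega>. f \<omega> * ln (f \<omega>) \<partial>restr_to_subalg R G)"
proof -
  let ?R = "restr_to_subalg R G"
  let ?Q = "density ?R (\<lambda>\<omega>. ennreal (f \<omega>))"
  interpret sigma_finite_measure ?R by fact
  have Q: "restr_to_subalg ?Q G = ?Q"
    by (rule restr_to_subalg_self) (simp add: sets_restr_to_subalg[OF sub])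
  have "AE \<omega> in ?R. ennreal (f \<omega>) = RN_deriv ?R ?Q \<omega>"
    by (rule RN_deriv_unique) auto
  then have Z: "AE \<omega> in ?R. f \<omega> * ln (f \<omega>) = enn2real (RN_deriv ?R ?Q \<omega>) * ln (enn2real (RN_deriv ?R ?Q \<omega>))"
  proof eventually_elim
    case (elim \<omega>)
    then have "enn2real (RN_deriv ?R ?Q \<omega>) = f \<omega>" using f_nonneg by (metis enn2real_ennreal)
    then show ?case by simp
  qed
  have ac: "absolutely_continuous ?R ?Q" by (rule absolutely_continuousI_density) measurable
  have "integrable ?R (\<lambda>\<omega>. enn2real (RN_deriv ?R ?Q \<omega>) * ln (enn2real (RN_deriv ?R ?Q \<omega>)))"
    using int integrable_cong_AE[THEN iffD1, OF _ _ Z] by auto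
  moreover have "(\<integral>\<omega>. enn2real (RN_deriv ?R ?Q \<omega>) * ln (enn2real (RN_deriv ?R ?Q \<omega>)) \<partial>?R) = (\<integral>\<omega>. f \<omega> * ln (f \<omega>) \<partial>?R)"
    by (rule integral_cong_AE[OF _ _ AE_symmetric[OF Z]]) measurable
  ultimately show ?thesis
    unfolding rel_entropy_def Let_def Q using ac by simp
qed

text \<open>Young's inequality \<open>z y \<le> z ln z + exp (y - 1)\<close> at \<open>y = x - ln c + 1\<close>.\<close>
lemma entropy_young:
  fixes z x c :: real
  assumes "0 \<le> z" "0 < c"
  shows "z * (x - ln c) + z - exp x / c \<le> z * ln z"
proof (cases "z = 0")
  case False
  then have z: "0 < z" using assms by simp
  have "ln (exp x / (c * z)) \<le> exp x / (c * z) - 1"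
    using z assms by (intro ln_le_minus_one) simp
  moreover have "ln (exp x / (c * z)) = x - ln c - ln z"
    using z assms by (simp add: ln_div ln_mult)
  ultimately have "z * (x - ln c - ln z) \<le> z * (exp x / (c * z) - 1)"
    using z by (intro mult_left_mono) auto
  also have "\<dots> = exp x / c - z" using z assms by (simp add: field_simps)
  finally show ?thesis by (simp add: algebra_simps)
qed (use assms in simp)

text \<open>The Gibbs variational inequality \<open>I(Q, R) \<ge> E\<^sub>Q X - ln E\<^sub>R exp X\<close> for a variable with
  \<open>E\<^sub>Q X = 0\<close>: integrate Young's inequality with \<open>z\<close> the density of \<open>Q\<close>.\<close>
lemma rel_entropy_lower_bound:
  assumes R: "prob_space R" and sub: "subalgebra R G"
    and Q: "prob_space Q" "sets Q = sets G"
    and X: "integrable Q X" "(\<integral>\<omega>. X \<omega> \<partial>Q) = 0"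
    and c: "(\<integral>\<^sup>+\<omega>. ennreal (exp (X \<omega>)) \<partial>R) = ennreal c" "0 < c"
  shows "ereal (- ln c) \<le> rel_entropy G Q R"
proof -
  let ?R = "restr_to_subalg R G"
  let ?D = "RN_deriv ?R Q"
  define Z where "Z \<omega> = enn2real (?D \<omega>)" for \<omega>
  interpret R: prob_space ?R by (rule prob_space_restr_to_subalg[OF sub R])
  interpret Q: prob_space Q by fact
  have Q': "restr_to_subalg Q G = Q" by (rule restr_to_subalg_self) fact
  show ?thesis
  proof (cases "absolutely_continuous ?R Q \<and> integrable ?R (\<lambda>\<omega>. Z \<omega> * ln (Z \<omega>))")
    case True
    have setsQ: "sets Q = sets ?R" using Q sub by (simp add: sets_restr_to_subalg)
    have XG: "X \<in> borel_measurable G" using X(1) Q(2) measurable_cong_sets[OF Q(2) refl] by auto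
    have XR [measurable]: "X \<in> borel_measurable ?R"
      using measurable_cong_sets[OF setsQ refl] X(1) by auto
    have Zm [measurable]: "Z \<in> borel_measurable ?R" unfolding Z_def by measurable
    have "density ?R ?D = Q" using R.density_RN_deriv[of Q] True setsQ by simp
    moreover have "AE \<omega> in ?R. ?D \<omega> \<noteq> \<infinity>"
      using R.RN_deriv_finite[OF Q.sigma_finite_measure_axioms] True setsQ by simp
    then have AE: "AE \<omega> in ?R. ?D \<omega> = ennreal (Z \<omega>)" by eventually_elim (auto simp: less_top Z_def)
    have "density ?R ?D = density ?R (\<lambda>\<omega>. ennreal (Z \<omega>))"
      by (rule density_cong[OF _ _ AE]) measurable
    ultimately have dens: "Q = density ?R (\<lambda>\<omega>. ennreal (Z \<omega>))" by simp
    have dens_int: "integrable Q h \<longleftrightarrow> integrable ?R (\<lambda>\<omega>. Z \<omega> * h \<omega>)"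
      and dens_integral: "(\<integral>\<omega>. h \<omega> \<partial>Q) = (\<integral>\<omega>. Z \<omega> * h \<omega> \<partial>?R)"
      if h: "h \<in> borel_measurable ?R" for h :: "'a \<Rightarrow> real"
      using integrable_real_density[OF Zm _ h] integral_real_density[OF Zm _ h]
      unfolding dens[symmetric] by (auto simp: Z_def)
    have ZX: "integrable ?R (\<lambda>\<omega>. Z \<omega> * X \<omega>)" "(\<integral>\<omega>. Z \<omega> * X \<omega> \<partial>?R) = 0"
      using X dens_int[OF XR] dens_integral[OF XR] by auto
    have Z1: "integrable ?R Z" "(\<integral>\<omega>. Z \<omega> \<partial>?R) = 1"
      using dens_int[of "\<lambda>_. 1"] dens_integral[of "\<lambda>_. 1"] by (simp_all add: Q.prob_space)
    have e: "(\<integral>\<^sup>+\<omega>. ennreal (exp (X \<omega>)) \<partial>?R) = ennreal c"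
      using c(1) nn_integral_subalgebra2[OF sub, of "\<lambda>\<omega>. ennreal (exp (X \<omega>))"] XG by simp
    have E1: "integrable ?R (\<lambda>\<omega>. exp (X \<omega>))" by (rule integrableI_nonneg) (use e in auto)
    have E2: "(\<integral>\<omega>. exp (X \<omega>) \<partial>?R) = c"
      by (subst integral_eq_nn_integral) (use e c(2) in auto)
    have "- ln c = (\<integral>\<omega>. Z \<omega> * X \<omega> - ln c * Z \<omega> + Z \<omega> - exp (X \<omega>) / c \<partial>?R)"
      using ZX Z1 E1 E2 c(2) by simp
    also have "\<dots> \<le> (\<integral>\<omega>. Z \<omega> * ln (Z \<omega>) \<partial>?R)"
    proof (rule integral_mono)
      fix \<omega>
      show "Z \<omega> * X \<omega> - ln c * Z \<omega> + Z \<omega> - exp (X \<omega>) / c \<le> Z \<omega> * ln (Z \<omega>)"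
        using entropy_young[of "Z \<omega>" c "X \<omega>"] c(2) by (simp add: algebra_simps Z_def)
    qed (use True ZX Z1 E1 in auto)
    finally show ?thesis using True unfolding rel_entropy_def Let_def Q' Z_def by simp
  next
    case False
    then show ?thesis unfolding rel_entropy_def Let_def Q' Z_def by (simp only: if_False) simp
  qed
qed

section \<open>Esscher measures of the approximating measures\<close>

lemma (in prob_space) nn_integral_exp_pos:
  assumes [measurable]: "f \<in> borel_measurable M"
  shows "0 < (\<integral>\<^sup>+\<omega>. ennreal (exp (f \<omega>)) \<partial>M)"
proof (rule ccontr)
  assume "\<not> ?thesis"
  then have "(\<integral>\<^sup>+\<omega>. ennreal (exp (f \<omega>)) \<partial>M) = 0" by (simp add: not_less)
  then have "AE \<omega> in M. ennreal (exp (f \<omega>)) = 0" by (subst (asm) nn_integral_0_iff_AE) auto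
  then have "AE \<omega> in M. False" by eventually_elim (simp add: ennreal_eq_0_iff)
  then show False by simp
qed

definition big_jumps_sq :: "real \<Rightarrow> (real \<Rightarrow> 'a \<Rightarrow> real) \<Rightarrow> 'a \<Rightarrow> real" where
  "big_jumps_sq T L \<omega> = (\<Sum>\<^sub>\<infinity>u\<in>{0<..T}. if 1 < \<bar>jump L u \<omega>\<bar> then (jump L u \<omega>)\<^sup>2 else 0)"

lemma big_jumps_sq_nonneg: "0 \<le> big_jumps_sq T L \<omega>"
  unfolding big_jumps_sq_def by (rule infsum_nonneg) simp

lemma infsum_rho_jumps: "(\<Sum>\<^sub>\<infinity>u\<in>{0<..T}. rho n (jump L u \<omega>)) = big_jumps_sq T L \<omega> / real n"
proof -
  have "rho n x = (if 1 < \<bar>x\<bar> then x\<^sup>2 else 0) * inverse (real n)" for x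
    by (simp add: rho_def divide_inverse)
  then show ?thesis
    unfolding big_jumps_sq_def by (simp only: infsum_cmult_left' divide_inverse)
qed

lemma rho_measurable [measurable]: "rho n \<in> borel_measurable borel"
  unfolding rho_def[abs_def] by measurable

context levy_on_horizon
begin

abbreviation "S \<equiv> big_jumps_sq T L"

abbreviation "P\<^sub>T \<equiv> restr_to_subalg P (F T)"

lemma subalg_T: "subalgebra P (F T)" using subalg[of T] by simp

lemma prob_space_P\<^sub>T: "prob_space P\<^sub>T"
  by (rule prob_space_restr_to_subalg[OF subalg_T prob_space_axioms])

lemma sets_P\<^sub>T [measurable_cong]: "sets P\<^sub>T = sets (F T)" by (rule sets_restr_to_subalg[OF subalg_T])

lemma space_P\<^sub>T: "space P\<^sub>T = space P" by (rule space_restr_to_subalg)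

lemma S_measurable [measurable]: "S \<in> borel_measurable (F T)"
  unfolding big_jumps_sq_def[abs_def]
  by (rule jump_sum_measurable[of "\<lambda>x. x\<^sup>2"]) (intro continuous_intros)

lemma L_T_measurable [measurable]: "L T \<in> borel_measurable (F T)" by (rule L_adapted) auto

lemma nn_integral_P\<^sub>T: "f \<in> borel_measurable (F T) \<Longrightarrow> (\<integral>\<^sup>+\<omega>. f \<omega> \<partial>P\<^sub>T) = (\<integral>\<^sup>+\<omega>. f \<omega> \<partial>P)"
  by (rule nn_integral_subalgebra2[OF subalg_T])

text \<open>Dominated convergence: the integrand vanishes for \<open>\<bar>x\<bar> \<le> 1\<close> and is bounded by \<open>1\<close>, and
  \<open>\<nu>\<close> gives finite mass to the large jumps.\<close>
lemma compensator_tendsto_0: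
  assumes \<nu>: "is_levy_measure P T L \<nu>"
  shows "(\<lambda>n. \<integral>x. (1 - exp (- rho n x)) \<partial>\<nu>) \<longlonglongrightarrow> 0"
proof -
  have sets_\<nu> [measurable_cong]: "sets \<nu> = sets borel" using \<nu> by (simp add: is_levy_measure_def)
  let ?B = "{x :: real. 1 < \<bar>x\<bar>}"
  have B: "?B \<in> sets borel" by measurable
  have "emeasure \<nu> ?B = (\<integral>\<^sup>+\<omega>. emeasure (count_space UNIV) {u\<in>{0<..T}. jump L u \<omega> \<noteq> 0 \<and> jump L u \<omega> \<in> ?B} \<partial>P) / ennreal T"
    using \<nu> B unfolding is_levy_measure_def by blast
  also have "(\<lambda>\<omega>. {u\<in>{0<..T}. jump L u \<omega> \<noteq> 0 \<and> jump L u \<omega> \<in> ?B}) = (\<lambda>\<omega>. {u\<in>{0<..T}. 1 < \<bar>jump L u \<omega>\<bar>})"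
    by (rule ext) auto
  finally have "emeasure \<nu> ?B = (\<integral>\<^sup>+\<omega>. emeasure (count_space UNIV) {u\<in>{0<..T}. 1 < \<bar>jump L u \<omega>\<bar>} \<partial>P) / ennreal T" .
  also have "\<dots> < \<infinity>"
    using expected_large_jumps_finite horizon_pos
    by (simp add: ennreal_divide_eq_top_iff less_top[symmetric] ennreal_eq_0_iff)
  finally have fin: "emeasure \<nu> ?B < \<infinity>" .
  have "(\<lambda>n. \<integral>x. (1 - exp (- rho n x)) \<partial>\<nu>) \<longlonglongrightarrow> (\<integral>x. 0 \<partial>\<nu>)"
  proof (rule integral_dominated_convergence[where w = "indicator ?B"])
    show "integrable \<nu> (indicator ?B :: real \<Rightarrow> real)"
      using fin B by (simp add: integrable_indicator_iff sets_\<nu>)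
    show "AE x in \<nu>. (\<lambda>n. 1 - exp (- rho n x)) \<longlonglongrightarrow> 0"
    proof (rule AE_I2)
      fix x
      have "(\<lambda>n. rho n x) \<longlonglongrightarrow> 0"
        by (cases "1 < \<bar>x\<bar>") (simp_all add: rho_def lim_const_over_n)
      then have "(\<lambda>n. 1 - exp (- rho n x)) \<longlonglongrightarrow> 1 - exp (- 0)" by (intro tendsto_intros)
      then show "(\<lambda>n. 1 - exp (- rho n x)) \<longlonglongrightarrow> 0" by simp
    qed
    show "AE x in \<nu>. norm (1 - exp (- rho n x)) \<le> indicator ?B x" for n
      by (rule AE_I2) (auto simp: rho_def indicator_def)
  qed measurable
  then show ?thesis by simp
qed

lemma P_approx_density:
  "P_approx P F T L \<nu> n = density P\<^sub>T (\<lambda>\<omega>. ennreal (exp (T * (\<integral>x. (1 - exp (- rho n x)) \<partial>\<nu>)) * exp (- (S \<omega> / real n))))"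
proof -
  have "Z_approx T L \<nu> n = (\<lambda>\<omega>. exp (T * (\<integral>x. (1 - exp (- rho n x)) \<partial>\<nu>)) * exp (- (S \<omega> / real n)))"
    by (rule ext) (simp add: Z_approx_def infsum_rho_jumps exp_add[symmetric])
  then show ?thesis by (simp add: P_approx_def)
qed

definition damped_mgf :: "nat \<Rightarrow> real \<Rightarrow> ennreal" where
  "damped_mgf n \<kappa> = (\<integral>\<^sup>+\<omega>. ennreal (exp (\<kappa> * L T \<omega> - S \<omega> / real n)) \<partial>P)"

text \<open>The parameter \<open>m\<close> is the normalising constant, a real number; the right choice is the value of
  \<open>damped_mgf n \<kappa>\<close> if that is finite.\<close>
definition damped_esscher :: "nat \<Rightarrow> real \<Rightarrow> real \<Rightarrow> 'a measure" where
  "damped_esscher n \<kappa> m = density P\<^sub>T (\<lambda>\<omega>. ennreal (exp (\<kappa> * L T \<omega> - S \<omega> / real n) / m))"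

text \<open>Mean zero of \<open>L T\<close> under the tilted measure is the first-order condition for \<open>\<kappa>\<close> to minimise
  \<open>damped_mgf n\<close>, whose minimum is then \<open>m\<close>.\<close>
definition martingale_tilt :: "nat \<Rightarrow> real \<Rightarrow> real \<Rightarrow> bool" where
  "martingale_tilt n \<kappa> m \<longleftrightarrow> 0 < m \<and> damped_mgf n \<kappa> = ennreal m \<and>
     integrable (damped_esscher n \<kappa> m) (L T) \<and> (\<integral>\<omega>. L T \<omega> \<partial>damped_esscher n \<kappa> m) = 0"

lemma damped_mgf_P\<^sub>T: "(\<integral>\<^sup>+\<omega>. ennreal (exp (\<kappa> * L T \<omega> - S \<omega> / real n)) \<partial>P\<^sub>T) = damped_mgf n \<kappa>"
  unfolding damped_mgf_def by (rule nn_integral_P\<^sub>T) measurable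

lemma prob_space_damped_esscher:
  assumes "0 < m" "damped_mgf n \<kappa> = ennreal m"
  shows "prob_space (damped_esscher n \<kappa> m)"
proof (rule prob_spaceI)
  have "emeasure (damped_esscher n \<kappa> m) (space (damped_esscher n \<kappa> m))
      = (\<integral>\<^sup>+\<omega>. ennreal (exp (\<kappa> * L T \<omega> - S \<omega> / real n)) / ennreal m \<partial>P\<^sub>T)"
    using assms(1) unfolding damped_esscher_def
    by (subst emeasure_density)
       (auto intro!: nn_integral_cong simp: divide_ennreal indicator_def)
  also have "\<dots> = 1"
    using assms by (subst nn_integral_divide) (simp_all add: damped_mgf_P\<^sub>T ennreal_divide_self)
  finally show "emeasure (damped_esscher n \<kappa> m) (space (damped_esscher n \<kappa> m)) = 1" .
qed

lemma sets_damped_esscher [simp]: "sets (damped_esscher n \<kappa> m) = sets (F T)"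
  by (simp add: damped_esscher_def sets_P\<^sub>T)

lemma space_damped_esscher [simp]: "space (damped_esscher n \<kappa> m) = space P"
  by (simp add: damped_esscher_def space_P\<^sub>T)

lemma
  fixes h :: "'a \<Rightarrow> real"
  assumes m: "0 < m" and h: "h \<in> borel_measurable (F T)"
  shows integrable_damped_esscher: "integrable (damped_esscher n \<kappa> m) h \<longleftrightarrow>
      integrable P\<^sub>T (\<lambda>\<omega>. exp (\<kappa> * L T \<omega> - S \<omega> / real n) / m * h \<omega>)"
    and integral_damped_esscher: "(\<integral>\<omega>. h \<omega> \<partial>damped_esscher n \<kappa> m) =
      (\<integral>\<omega>. exp (\<kappa> * L T \<omega> - S \<omega> / real n) / m * h \<omega> \<partial>P\<^sub>T)"
proof -
  have h' [measurable]: "h \<in> borel_measurable P\<^sub>T" using h by measurable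
  have f: "(\<lambda>\<omega>. exp (\<kappa> * L T \<omega> - S \<omega> / real n) / m) \<in> borel_measurable P\<^sub>T" by measurable
  have nn: "AE \<omega> in P\<^sub>T. 0 \<le> exp (\<kappa> * L T \<omega> - S \<omega> / real n) / m" using m by simp
  show "integrable (damped_esscher n \<kappa> m) h \<longleftrightarrow>
      integrable P\<^sub>T (\<lambda>\<omega>. exp (\<kappa> * L T \<omega> - S \<omega> / real n) / m * h \<omega>)"
    unfolding damped_esscher_def by (rule integrable_real_density[OF f nn h'])
  show "(\<integral>\<omega>. h \<omega> \<partial>damped_esscher n \<kappa> m) =
      (\<integral>\<omega>. exp (\<kappa> * L T \<omega> - S \<omega> / real n) / m * h \<omega> \<partial>P\<^sub>T)"
    unfolding damped_esscher_def by (rule integral_real_density[OF f nn h'])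
qed

text \<open>The compensator is a constant factor \<open>K\<close> of the approximating density and of the normalising constant
  \<open>K m\<close>, hence cancels.  Mean zero follows from the martingale property at time \<open>0\<close>, where \<open>L\<close>
  vanishes.\<close>
lemma EMM_is_damped_esscher:
  assumes EMM: "is_EMM (P_approx P F T L \<nu> n) F T L Q"
  shows "\<exists>\<kappa> m. martingale_tilt n \<kappa> m \<and> Q = damped_esscher n \<kappa> m"
proof -
  define K where "K = exp (T * (\<integral>x. (1 - exp (- rho n x)) \<partial>\<nu>))"
  have K: "0 < K" by (simp add: K_def)
  let ?Pn = "P_approx P F T L \<nu> n"
  have Pn: "?Pn = density P\<^sub>T (\<lambda>\<omega>. ennreal (K * exp (- (S \<omega> / real n))))"
    unfolding K_def by (rule P_approx_density)
  obtain \<kappa> where int: "integrable ?Pn (\<lambda>\<omega>. exp (\<kappa> * L T \<omega>))" and Q: "Q = esscher ?Pn T L \<kappa>"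
    using EMM by (auto simp: is_EMM_def)
  have mart: "martingale_on Q F T L" using EMM by (simp add: is_EMM_def)
  have e: "(\<integral>\<^sup>+\<omega>. ennreal (exp (\<kappa> * L T \<omega>)) \<partial>?Pn) = ennreal K * damped_mgf n \<kappa>"
  proof -
    have "(\<integral>\<^sup>+\<omega>. ennreal (exp (\<kappa> * L T \<omega>)) \<partial>?Pn)
        = (\<integral>\<^sup>+\<omega>. ennreal (K * exp (- (S \<omega> / real n))) * ennreal (exp (\<kappa> * L T \<omega>)) \<partial>P\<^sub>T)"
      unfolding Pn by (rule nn_integral_density) measurable
    also have "\<dots> = (\<integral>\<^sup>+\<omega>. ennreal K * ennreal (exp (\<kappa> * L T \<omega> - S \<omega> / real n)) \<partial>P\<^sub>T)"
    proof (rule nn_integral_cong)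
      fix \<omega>
      have "K * exp (- (S \<omega> / real n)) * exp (\<kappa> * L T \<omega>) = K * exp (\<kappa> * L T \<omega> - S \<omega> / real n)"
        by (simp add: exp_diff exp_minus field_simps)
      then show "ennreal (K * exp (- (S \<omega> / real n))) * ennreal (exp (\<kappa> * L T \<omega>))
          = ennreal K * ennreal (exp (\<kappa> * L T \<omega> - S \<omega> / real n))"
        using K by (simp add: ennreal_mult[symmetric])
    qed
    also have "\<dots> = ennreal K * damped_mgf n \<kappa>"
      by (subst nn_integral_cmult) (simp_all add: damped_mgf_P\<^sub>T)
    finally show ?thesis .
  qed
  have "(\<integral>\<^sup>+\<omega>. ennreal (exp (\<kappa> * L T \<omega>)) \<partial>?Pn) < \<infinity>"
    using int by (simp add: integrable_iff_bounded)
  then have "damped_mgf n \<kappa> \<noteq> \<infinity>" using e K by (auto simp: ennreal_mult_top ennreal_eq_0_iff)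
  moreover have "0 < damped_mgf n \<kappa>"
    unfolding damped_mgf_def by (rule nn_integral_exp_pos) (rule F_P_measurable[of T], simp, measurable)
  ultimately obtain m where m: "damped_mgf n \<kappa> = ennreal m" "0 < m"
    by (cases "damped_mgf n \<kappa>") auto
  have I: "(\<integral>\<omega>. exp (\<kappa> * L T \<omega>) \<partial>?Pn) = K * m"
    using K m by (subst integral_eq_nn_integral) (use int e in \<open>auto simp: ennreal_mult[symmetric]\<close>)
  have "Q = density P\<^sub>T (\<lambda>\<omega>. ennreal (K * exp (- (S \<omega> / real n))) * ennreal (exp (\<kappa> * L T \<omega>) / (K * m)))"
    unfolding Q esscher_def I unfolding Pn by (rule density_density_eq) measurable
  also have "\<dots> = damped_esscher n \<kappa> m"
  proof -
    have "ennreal (K * exp (- (S \<omega> / real n))) * ennreal (exp (\<kappa> * L T \<omega>) / (K * m))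
        = ennreal (exp (\<kappa> * L T \<omega> - S \<omega> / real n) / m)" for \<omega>
    proof -
      have "K * exp (- (S \<omega> / real n)) * (exp (\<kappa> * L T \<omega>) / (K * m)) = exp (\<kappa> * L T \<omega> - S \<omega> / real n) / m"
        using K m by (simp add: exp_diff exp_minus field_simps)
      then show ?thesis using K m by (simp add: ennreal_mult[symmetric])
    qed
    then show ?thesis by (simp only: damped_esscher_def)
  qed
  finally have Q_eq: "Q = damped_esscher n \<kappa> m" .
  interpret Q: prob_space Q unfolding Q_eq by (rule prob_space_damped_esscher[OF m(2,1)])
  have sub: "subalgebra Q (F 0)"
    using sets_F_mono[of 0 T] by (simp add: subalgebra_def Q_eq)
  interpret finite_measure_subalgebra Q "F 0" by unfold_locales (rule sub)
  have L_int: "integrable Q (L T)" using mart by (simp add: martingale_on_def)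
  have "AE \<omega> in Q. real_cond_exp Q (F 0) (L T) \<omega> = L 0 \<omega>"
    using mart horizon_nonneg unfolding martingale_on_def by blast
  then have "AE \<omega> in Q. real_cond_exp Q (F 0) (L T) \<omega> = 0"
    using AE_space by eventually_elim (simp add: Q_eq L_0)
  then have "(\<integral>\<omega>. real_cond_exp Q (F 0) (L T) \<omega> \<partial>Q) = 0" by (rule integral_eq_zero_AE)
  then have "(\<integral>\<omega>. L T \<omega> \<partial>Q) = 0" using real_cond_exp_int(2)[OF L_int] by simp
  then show ?thesis using m L_int Q_eq unfolding martingale_tilt_def by blast
qed

text \<open>Integrate the tangent inequality
  \<open>exp (\<kappa>' X) \<ge> exp (\<kappa> X) (1 + (\<kappa>' - \<kappa>) X)\<close>; the linear term has mean zero.\<close>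
lemma martingale_tilt_minimises:
  assumes tilt: "martingale_tilt n \<kappa> m"
  shows "damped_mgf n \<kappa> \<le> damped_mgf n \<kappa>'"
proof (cases "damped_mgf n \<kappa>'")
  case (real r)
  let ?Q = "damped_esscher n \<kappa> m"
  have m: "0 < m" "damped_mgf n \<kappa> = ennreal m"
    and Li: "integrable ?Q (L T)" "(\<integral>\<omega>. L T \<omega> \<partial>?Q) = 0"
    using tilt by (auto simp: martingale_tilt_def)
  interpret Q: prob_space ?Q by (rule prob_space_damped_esscher[OF m])
  let ?e = "\<lambda>\<kappa> \<omega>. exp (\<kappa> * L T \<omega> - S \<omega> / real n)"
  have h: "(\<lambda>\<omega>. 1 + (\<kappa>' - \<kappa>) * L T \<omega>) \<in> borel_measurable (F T)" by measurable
  have hi: "integrable ?Q (\<lambda>\<omega>. 1 + (\<kappa>' - \<kappa>) * L T \<omega>)" using Li by simp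
  have "1 = (\<integral>\<omega>. 1 + (\<kappa>' - \<kappa>) * L T \<omega> \<partial>?Q)" using Li Q.prob_space by simp
  also have "\<dots> = (\<integral>\<omega>. ?e \<kappa> \<omega> / m * (1 + (\<kappa>' - \<kappa>) * L T \<omega>) \<partial>P\<^sub>T)"
    by (rule integral_damped_esscher[OF m(1) h])
  also have "\<dots> \<le> (\<integral>\<omega>. ?e \<kappa>' \<omega> / m \<partial>P\<^sub>T)"
  proof (rule integral_mono)
    show "integrable P\<^sub>T (\<lambda>\<omega>. ?e \<kappa> \<omega> / m * (1 + (\<kappa>' - \<kappa>) * L T \<omega>))"
      using hi integrable_damped_esscher[OF m(1) h] by simp
    have "integrable P\<^sub>T (?e \<kappa>')"
      by (rule integrableI_nonneg) (use real damped_mgf_P\<^sub>T[of \<kappa>' n] in auto)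
    then show "integrable P\<^sub>T (\<lambda>\<omega>. ?e \<kappa>' \<omega> / m)" by simp
    fix \<omega>
    have "?e \<kappa> \<omega> * (1 + (\<kappa>' - \<kappa>) * L T \<omega>) \<le> ?e \<kappa> \<omega> * exp ((\<kappa>' - \<kappa>) * L T \<omega>)"
      by (intro mult_left_mono exp_ge_add_one_self) simp
    also have "\<dots> = ?e \<kappa>' \<omega>" by (simp add: exp_add[symmetric] algebra_simps)
    finally show "?e \<kappa> \<omega> / m * (1 + (\<kappa>' - \<kappa>) * L T \<omega>) \<le> ?e \<kappa>' \<omega> / m"
      using m(1) by (simp add: divide_right_mono)
  qed
  also have "\<dots> = r / m"
    using integral_eq_nn_integral[of "?e \<kappa>'" "P\<^sub>T"] real damped_mgf_P\<^sub>T[of \<kappa>' n] by simp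
  finally have "m \<le> r" using m(1) by (simp add: field_simps)
  then show ?thesis using real m(2) by (simp add: ennreal_leI)
qed simp

text \<open>With respect to the approximating measure the logarithm of the density is affine in \<open>L T\<close>, and
  \<open>L T\<close> has mean zero.\<close>
lemma entropy_wrt_approx:
  assumes tilt: "martingale_tilt n \<kappa> m"
  shows "rel_entropy (F T) (damped_esscher n \<kappa> m) (P_approx P F T L \<nu> n)
    = ereal (- (T * (\<integral>x. (1 - exp (- rho n x)) \<partial>\<nu>)) - ln m)"
proof -
  define C where "C = T * (\<integral>x. (1 - exp (- rho n x)) \<partial>\<nu>)"
  let ?Pn = "P_approx P F T L \<nu> n"
  let ?Q = "damped_esscher n \<kappa> m"
  have m: "0 < m" "damped_mgf n \<kappa> = ennreal m"
    and Li: "integrable ?Q (L T)" "(\<integral>\<omega>. L T \<omega> \<partial>?Q) = 0"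
    using tilt by (auto simp: martingale_tilt_def)
  interpret Q: prob_space ?Q by (rule prob_space_damped_esscher[OF m])
  interpret PT: prob_space P\<^sub>T by (rule prob_space_P\<^sub>T)
  have Pn: "?Pn = density P\<^sub>T (\<lambda>\<omega>. ennreal (exp C * exp (- (S \<omega> / real n))))"
    unfolding C_def by (rule P_approx_density)
  have sets_Pn [measurable_cong]: "sets ?Pn = sets (F T)" by (simp add: Pn sets_P\<^sub>T)
  have restr: "restr_to_subalg ?Pn (F T) = ?Pn" by (rule restr_to_subalg_self) (rule sets_Pn)
  have sub: "subalgebra ?Pn (F T)"
    using sets_Pn by (simp add: subalgebra_def Pn space_P\<^sub>T)
  have "emeasure ?Pn (space ?Pn)
      = (\<integral>\<^sup>+\<omega>. ennreal (exp C * exp (- (S \<omega> / real n))) * indicator (space P\<^sub>T) \<omega> \<partial>P\<^sub>T)"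
    unfolding Pn by (subst emeasure_density) auto
  also have "\<dots> \<le> (\<integral>\<^sup>+\<omega>. ennreal (exp C) \<partial>P\<^sub>T)"
  proof (rule nn_integral_mono)
    fix \<omega>
    have "exp C * exp (- (S \<omega> / real n)) \<le> exp C * 1"
      by (intro mult_left_mono) (simp_all add: big_jumps_sq_nonneg)
    then show "ennreal (exp C * exp (- (S \<omega> / real n))) * indicator (space P\<^sub>T) \<omega> \<le> ennreal (exp C)"
      by (simp add: indicator_def ennreal_leI)
  qed
  also have "\<dots> < \<infinity>" by (simp add: PT.emeasure_space_1)
  finally have "finite_measure ?Pn" by (intro finite_measureI) auto
  then interpret Pn: finite_measure ?Pn .
  let ?f = "\<lambda>\<omega>. exp (\<kappa> * L T \<omega>) / (exp C * m)"
  have f [measurable]: "?f \<in> borel_measurable ?Pn" by measurable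
  have Q_dens: "?Q = density ?Pn (\<lambda>\<omega>. ennreal (?f \<omega>))"
  proof -
    have "density ?Pn (\<lambda>\<omega>. ennreal (?f \<omega>))
        = density P\<^sub>T (\<lambda>\<omega>. ennreal (exp C * exp (- (S \<omega> / real n))) * ennreal (?f \<omega>))"
      unfolding Pn by (rule density_density_eq) measurable
    also have "(\<lambda>\<omega>. ennreal (exp C * exp (- (S \<omega> / real n))) * ennreal (?f \<omega>))
        = (\<lambda>\<omega>. ennreal (exp (\<kappa> * L T \<omega> - S \<omega> / real n) / m))"
    proof
      fix \<omega>
      have "exp C * exp (- (S \<omega> / real n)) * ?f \<omega> = exp (\<kappa> * L T \<omega> - S \<omega> / real n) / m"
        using m(1) by (simp add: exp_diff exp_minus field_simps)
      then show "ennreal (exp C * exp (- (S \<omega> / real n))) * ennreal (?f \<omega>)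
          = ennreal (exp (\<kappa> * L T \<omega> - S \<omega> / real n) / m)"
        using m(1) by (simp add: ennreal_mult[symmetric])
    qed
    finally show ?thesis by (simp only: damped_esscher_def)
  qed
  have ln_f: "?f \<omega> * ln (?f \<omega>) = ?f \<omega> * (\<kappa> * L T \<omega> - C - ln m)" for \<omega>
    using m(1) by (simp add: ln_div ln_mult)
  have h: "(\<lambda>\<omega>. \<kappa> * L T \<omega> - C - ln m) \<in> borel_measurable ?Pn" by measurable
  have hi: "integrable ?Q (\<lambda>\<omega>. \<kappa> * L T \<omega> - C - ln m)" using Li by simp
  have nn: "AE \<omega> in ?Pn. 0 \<le> ?f \<omega>" using m(1) by simp
  have int: "integrable ?Pn (\<lambda>\<omega>. ?f \<omega> * ln (?f \<omega>))"
    unfolding ln_f using hi integrable_real_density[OF f nn h] by (simp only: Q_dens)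
  have "(\<integral>\<omega>. ?f \<omega> * ln (?f \<omega>) \<partial>?Pn) = (\<integral>\<omega>. \<kappa> * L T \<omega> - C - ln m \<partial>?Q)"
    unfolding ln_f Q_dens by (rule integral_real_density[OF f nn h, symmetric])
  also have "\<dots> = - C - ln m" using Li Q.prob_space by simp
  finally have val: "(\<integral>\<omega>. ?f \<omega> * ln (?f \<omega>) \<partial>?Pn) = - C - ln m" .
  have "rel_entropy (F T) (density (restr_to_subalg ?Pn (F T)) (\<lambda>\<omega>. ennreal (?f \<omega>))) ?Pn
      = ereal (\<integral>\<omega>. ?f \<omega> * ln (?f \<omega>) \<partial>restr_to_subalg ?Pn (F T))"
    by (rule rel_entropy_density[OF sub]) (use f int m(1) Pn.sigma_finite_measure_axioms in \<open>simp_all only: restr, simp\<close>)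
  then show ?thesis unfolding restr Q_dens[symmetric] val C_def[symmetric] .
qed

text \<open>With respect to \<open>P\<close> the logarithm of the density contains the additional term \<open>- S / n \<le> 0\<close>.
  Dropping it gives an integrable upper bound of \<open>f ln f\<close>, which together with the lower bound
  \<open>f ln f \<ge> -1\<close> also shows that the entropy is finite.\<close>
lemma entropy_wrt_P_le:
  assumes tilt: "martingale_tilt n \<kappa> m"
  shows "rel_entropy (F T) (damped_esscher n \<kappa> m) P \<le> ereal (- ln m)"
proof -
  let ?Q = "damped_esscher n \<kappa> m"
  have m: "0 < m" "damped_mgf n \<kappa> = ennreal m"
    and Li: "integrable ?Q (L T)" "(\<integral>\<omega>. L T \<omega> \<partial>?Q) = 0"
    using tilt by (auto simp: martingale_tilt_def)
  interpret Q: prob_space ?Q by (rule prob_space_damped_esscher[OF m])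
  interpret PT: prob_space P\<^sub>T by (rule prob_space_P\<^sub>T)
  let ?f = "\<lambda>\<omega>. exp (\<kappa> * L T \<omega> - S \<omega> / real n) / m"
  have f [measurable]: "?f \<in> borel_measurable P\<^sub>T" by measurable
  have f_pos: "0 < ?f \<omega>" for \<omega> using m(1) by simp
  have h: "(\<lambda>\<omega>. \<kappa> * L T \<omega> - ln m) \<in> borel_measurable (F T)" by measurable
  have hi: "integrable ?Q (\<lambda>\<omega>. \<kappa> * L T \<omega> - ln m)" using Li by simp
  have upper: "?f \<omega> * ln (?f \<omega>) \<le> ?f \<omega> * (\<kappa> * L T \<omega> - ln m)" for \<omega>
  proof (rule mult_left_mono)
    show "ln (?f \<omega>) \<le> \<kappa> * L T \<omega> - ln m"
      using m(1) big_jumps_sq_nonneg[of T L \<omega>] by (simp add: ln_div)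
  qed (use f_pos[of \<omega>] in simp)
  have lower: "- 1 \<le> ?f \<omega> * ln (?f \<omega>)" for \<omega>
    using entropy_young[of "?f \<omega>" 1 0] f_pos[of \<omega>] by simp
  have fh: "integrable P\<^sub>T (\<lambda>\<omega>. ?f \<omega> * (\<kappa> * L T \<omega> - ln m))"
    using hi integrable_damped_esscher[OF m(1) h] by simp
  have int: "integrable P\<^sub>T (\<lambda>\<omega>. ?f \<omega> * ln (?f \<omega>))"
  proof (rule Bochner_Integration.integrable_bound)
    show "integrable P\<^sub>T (\<lambda>\<omega>. 1 + \<bar>?f \<omega> * (\<kappa> * L T \<omega> - ln m)\<bar>)"
      by (intro Bochner_Integration.integrable_add integrable_abs fh PT.integrable_const)
    show "AE \<omega> in P\<^sub>T. norm (?f \<omega> * ln (?f \<omega>)) \<le> norm (1 + \<bar>?f \<omega> * (\<kappa> * L T \<omega> - ln m)\<bar>)"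
    proof (rule AE_I2)
      fix \<omega>
      show "norm (?f \<omega> * ln (?f \<omega>)) \<le> norm (1 + \<bar>?f \<omega> * (\<kappa> * L T \<omega> - ln m)\<bar>)"
        using upper[of \<omega>] lower[of \<omega>] unfolding real_norm_def by linarith
    qed
  qed measurable
  have "rel_entropy (F T) (density P\<^sub>T (\<lambda>\<omega>. ennreal (?f \<omega>))) P = ereal (\<integral>\<omega>. ?f \<omega> * ln (?f \<omega>) \<partial>P\<^sub>T)"
    by (rule rel_entropy_density[OF subalg_T PT.sigma_finite_measure_axioms f less_imp_le[OF f_pos] int])
  also have "\<dots> \<le> ereal (\<integral>\<omega>. ?f \<omega> * (\<kappa> * L T \<omega> - ln m) \<partial>P\<^sub>T)"
    unfolding ereal_less_eq by (rule integral_mono[OF int fh upper])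
  also have "(\<integral>\<omega>. ?f \<omega> * (\<kappa> * L T \<omega> - ln m) \<partial>P\<^sub>T) = (\<integral>\<omega>. \<kappa> * L T \<omega> - ln m \<partial>?Q)"
    by (rule integral_damped_esscher[OF m(1) h, symmetric])
  also have "\<dots> = - ln m" using Li Q.prob_space by simp
  finally show ?thesis by (simp only: damped_esscher_def)
qed

lemma damped_esscher_in_M_loc_a:
  assumes tilt: "martingale_tilt n \<kappa> m"
  shows "damped_esscher n \<kappa> m \<in> M_loc_a P F T L"
proof -
  have m: "0 < m" "damped_mgf n \<kappa> = ennreal m"
    and Li: "integrable (damped_esscher n \<kappa> m) (L T)" "(\<integral>\<omega>. L T \<omega> \<partial>damped_esscher n \<kappa> m) = 0"
    using tilt by (auto simp: martingale_tilt_def)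
  have "absolutely_continuous P\<^sub>T (damped_esscher n \<kappa> m)"
    unfolding damped_esscher_def by (rule absolutely_continuousI_density) measurable
  then show ?thesis
    unfolding M_loc_a_def using prob_space_damped_esscher[OF m] Li
    by (auto intro!: exI[of _ "\<lambda>_ _. T"] stopping_time_const simp: incseq_def)
qed

text \<open>Apply the Gibbs inequality to \<open>\<kappa> L\<close> stopped at each localising time.  The error term \<open>r k\<close> of the
  bound on stopped exponentials tends to zero by dominated convergence, because
  \<open>\<tau> k = T\<close> from some \<open>k\<close> on.\<close>
lemma entropy_lower_bound_M_loc_a:
  assumes Q: "Q \<in> M_loc_a P F T L" and c: "mgf P T L \<kappa> = ennreal c" "0 < c" "c \<le> 1"
  shows "ereal (- ln c) \<le> rel_entropy (F T) Q P"
proof -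
  have Q1: "prob_space Q" "sets Q = sets (F T)" using Q by (auto simp: M_loc_a_def)
  have "\<exists>\<tau> :: nat \<Rightarrow> 'a \<Rightarrow> real.
      (\<forall>k. stopping_time (extend_horizon T F) (\<tau> k) \<and> (\<forall>\<omega>\<in>space P. 0 \<le> \<tau> k \<omega>)) \<and>
      incseq (\<lambda>k. {\<omega>\<in>space P. \<tau> k \<omega> = T}) \<and>
      (\<Union>k. {\<omega>\<in>space P. \<tau> k \<omega> = T}) = space P \<and>
      (\<forall>k. integrable Q (\<lambda>\<omega>. L (min (\<tau> k \<omega>) T) \<omega>) \<and> (\<integral>\<omega>. L (min (\<tau> k \<omega>) T) \<omega> \<partial>Q) = 0)"
    using Q unfolding M_loc_a_def mem_Collect_eq by (elim conjE)
  then obtain \<tau> :: "nat \<Rightarrow> 'a \<Rightarrow> real" where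
    \<tau>: "\<forall>k. stopping_time (extend_horizon T F) (\<tau> k) \<and> (\<forall>\<omega>\<in>space P. 0 \<le> \<tau> k \<omega>)"
    and inc: "incseq (\<lambda>k. {\<omega>\<in>space P. \<tau> k \<omega> = T})" and un: "(\<Union>k. {\<omega>\<in>space P. \<tau> k \<omega> = T}) = space P"
    and stopped: "\<forall>k. integrable Q (\<lambda>\<omega>. L (min (\<tau> k \<omega>) T) \<omega>) \<and> (\<integral>\<omega>. L (min (\<tau> k \<omega>) T) \<omega> \<partial>Q) = 0"
    by (elim exE conjE)
  have st: "stopping_time (extend_horizon T F) (\<tau> k)" for k using \<tau> by blast
  have \<tau>0: "0 \<le> \<tau> k \<omega>" if "\<omega> \<in> space P" for k \<omega> using \<tau> that by blast
  have X: "integrable Q (\<lambda>\<omega>. L (min (\<tau> k \<omega>) T) \<omega>)" "(\<integral>\<omega>. L (min (\<tau> k \<omega>) T) \<omega> \<partial>Q) = 0" for k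
    using stopped by blast+
  define r where "r k = (\<integral>\<^sup>+\<omega>. ennreal (exp (\<kappa> * L T \<omega>)) * indicator {\<omega>\<in>space P. \<tau> k \<omega> < T} \<omega> \<partial>P)" for k
  have [measurable]: "L T \<in> borel_measurable P" by (rule L_measurable) auto
  have meas [measurable]: "{\<omega>\<in>space P. \<tau> k \<omega> < T} \<in> events" for k
  proof -
    have "Measurable.pred (F T) (\<lambda>\<omega>. \<tau> k \<omega> < T)"
      using filtration.stopping_time_less_const[OF filtr st[of k], of T] by (simp add: extend_horizon_def)
    then have "Measurable.pred P (\<lambda>\<omega>. \<tau> k \<omega> < T)" by (rule F_P_measurable[rotated]) simp
    then show ?thesis by (simp add: pred_def)
  qed
  have "r \<longlonglongrightarrow> (\<integral>\<^sup>+\<omega>. 0 \<partial>P)"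
    unfolding r_def
  proof (rule nn_integral_dominated_convergence[where w = "\<lambda>\<omega>. ennreal (exp (\<kappa> * L T \<omega>))"])
    show "(\<integral>\<^sup>+\<omega>. ennreal (exp (\<kappa> * L T \<omega>)) \<partial>P) < \<infinity>" using c(1) by (simp add: mgf_def)
    show "AE \<omega> in P. (\<lambda>k. ennreal (exp (\<kappa> * L T \<omega>)) * indicator {\<omega>\<in>space P. \<tau> k \<omega> < T} \<omega>) \<longlonglongrightarrow> 0"
    proof (rule AE_I2)
      fix \<omega> assume "\<omega> \<in> space P"
      then obtain k where k: "\<omega> \<in> {\<omega>\<in>space P. \<tau> k \<omega> = T}" using un by blast
      have "eventually (\<lambda>j. ennreal (exp (\<kappa> * L T \<omega>)) * indicator {\<omega>\<in>space P. \<tau> j \<omega> < T} \<omega> = 0) sequentially"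
        using eventually_ge_at_top[of k]
      proof eventually_elim
        case (elim j)
        have "\<tau> j \<omega> = T" using incseqD[OF inc elim] k by blast
        then show ?case by simp
      qed
      then show "(\<lambda>k. ennreal (exp (\<kappa> * L T \<omega>)) * indicator {\<omega>\<in>space P. \<tau> k \<omega> < T} \<omega>) \<longlonglongrightarrow> 0"
        by (rule tendsto_eventually)
    qed
    show "AE \<omega> in P. ennreal (exp (\<kappa> * L T \<omega>)) * indicator {\<omega>\<in>space P. \<tau> k \<omega> < T} \<omega> \<le> ennreal (exp (\<kappa> * L T \<omega>))" for k
      by (rule AE_I2) (simp add: indicator_def)
  qed measurable
  then have r_lim: "r \<longlonglongrightarrow> 0" by simp
  have r_fin: "r k \<noteq> \<infinity>" for k
  proof -
    have "r k \<le> ennreal c" unfolding r_def c(1)[symmetric] mgf_def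
      by (intro nn_integral_mono) (simp add: indicator_def)
    then show ?thesis by (auto simp: top_unique)
  qed
  have bound: "ereal (- ln (c + enn2real (r k) / c)) \<le> rel_entropy (F T) Q P" for k
  proof -
    let ?X = "\<lambda>\<omega>. L (min (\<tau> k \<omega>) T) \<omega>"
    have "?X \<in> borel_measurable Q" using X(1)[of k] by (rule borel_measurable_integrable)
    then have "?X \<in> borel_measurable (F T)" using measurable_cong_sets[OF Q1(2) refl] by blast
    then have XP [measurable]: "?X \<in> borel_measurable P" by (rule F_P_measurable[rotated]) simp
    define d where "d = (\<integral>\<^sup>+\<omega>. ennreal (exp (\<kappa> * ?X \<omega>)) \<partial>P)"
    have "mgf P T L \<kappa> * d \<le> mgf P T L \<kappa> * mgf P T L \<kappa> + r k"
      unfolding d_def r_def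
      by (rule stopped_exp_bound[OF _ st[of k]]) (use c \<tau>0 in auto)
    then have le: "ennreal c * d \<le> ennreal (c * c + enn2real (r k))"
      using r_fin[of k] c by (simp add: ennreal_mult[symmetric] ennreal_plus less_top)
    have "0 < d" unfolding d_def by (rule nn_integral_exp_pos) measurable
    moreover have "d \<noteq> \<infinity>" using le c(2) by (auto simp: ennreal_mult_top ennreal_eq_0_iff top_unique)
    ultimately obtain d' where d': "d = ennreal d'" "0 < d'" by (cases d) auto
    have "c * d' \<le> c * c + enn2real (r k)"
    proof (subst ennreal_le_iff[symmetric])
      show "0 \<le> c * c + enn2real (r k)" using c(2) by simp
      show "ennreal (c * d') \<le> ennreal (c * c + enn2real (r k))"
        using le unfolding d'(1) ennreal_mult[OF less_imp_le[OF c(2)] less_imp_le[OF d'(2)]] .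
    qed
    then have d_le: "d' \<le> c + enn2real (r k) / c" using c(2) by (simp add: field_simps)
    have "ereal (- ln d') \<le> rel_entropy (F T) Q P"
    proof (rule rel_entropy_lower_bound[OF prob_space_axioms subalg_T Q1])
      show "integrable Q (\<lambda>\<omega>. \<kappa> * ?X \<omega>)" "(\<integral>\<omega>. \<kappa> * ?X \<omega> \<partial>Q) = 0" using X[of k] by simp_all
      show "(\<integral>\<^sup>+\<omega>. ennreal (exp (\<kappa> * ?X \<omega>)) \<partial>P) = ennreal d'" using d' d_def by simp
    qed fact
    moreover have "- ln (c + enn2real (r k) / c) \<le> - ln d'" using d_le d'(2) by simp
    ultimately show ?thesis by (meson ereal_less_eq(3) order_trans)
  qed
  have r_real: "(\<lambda>k. enn2real (r k)) \<longlonglongrightarrow> 0"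
    using tendsto_enn2real[OF r_lim[folded ennreal_0]] by simp
  have "(\<lambda>k. - ln (c + enn2real (r k) / c)) \<longlonglongrightarrow> - ln (c + 0 / c)"
    using c(2) by (intro tendsto_minus tendsto_ln tendsto_add tendsto_divide tendsto_const r_real) auto
  then have "(\<lambda>k. ereal (- ln (c + enn2real (r k) / c))) \<longlonglongrightarrow> ereal (- ln c)" by simp
  then show ?thesis by (rule LIMSEQ_le_const2) (use bound in auto)
qed

end

section \<open>Convergence of the entropies\<close>

theorem theorem4p1:
  fixes P :: "'a measure"
    and F :: "real \<Rightarrow> 'a measure"
    and T :: real
    and L :: "real \<Rightarrow> 'a \<Rightarrow> real"
    and \<nu> :: "real measure"
    and \<kappa>\<^sub>0 :: real
    and PE :: "nat \<Rightarrow> 'a measure"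
  assumes "prob_space P"
    and "T > 0"
    and "filtration (space P) (extend_horizon T F)"
    and "\<And>t. t \<in> {0..T} \<Longrightarrow> subalgebra P (F t)"
    and "levy_process P F T L"
    and "is_levy_measure P T L \<nu>"
    and "\<not> subordinator P F T L"
    and "\<not> subordinator P F T (\<lambda>t \<omega>. - L t \<omega>)"
    and "\<And>\<kappa>. mgf P T L \<kappa>\<^sub>0 \<le> mgf P T L \<kappa>"
    and "\<And>n. n \<ge> 1 \<Longrightarrow> is_EMM (P_approx P F T L \<nu> n) F T L (PE n)"
  shows "((\<lambda>n. rel_entropy (F T) (PE n) P) \<longlonglongrightarrow> ereal (- ln (enn2real (mgf P T L \<kappa>\<^sub>0)))) \<and>
    ((\<lambda>n. rel_entropy (F T) (PE n) (P_approx P F T L \<nu> n))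
       \<longlonglongrightarrow> ereal (- ln (enn2real (mgf P T L \<kappa>\<^sub>0)))) \<and>
    (INF Q\<in>M_loc_a P F T L. rel_entropy (F T) Q P) = ereal (- ln (enn2real (mgf P T L \<kappa>\<^sub>0)))"
proof -
  interpret levy_on_horizon P F T L
    by (rule levy_on_horizon.intro[OF assms(1) levy_on_horizon_axioms.intro[OF assms(2-5)]])
  have L_T: "L T \<in> borel_measurable P" by (rule L_measurable) auto
  have S_P: "S \<in> borel_measurable P" by (rule F_P_measurable[OF _ S_measurable]) simp
  obtain c where c: "mgf P T L \<kappa>\<^sub>0 = ennreal c" "0 < c" "c \<le> 1"
  proof -
    have "0 < mgf P T L \<kappa>\<^sub>0" unfolding mgf_def by (intro nn_integral_exp_pos borel_measurable_times borel_measurable_const L_T)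
    moreover have "mgf P T L \<kappa>\<^sub>0 \<le> 1" using assms(9)[of 0] by (simp add: mgf_def emeasure_space_1)
    ultimately show thesis using that by (cases "mgf P T L \<kappa>\<^sub>0") (auto simp: top_unique)
  qed
  have "\<forall>n. \<exists>\<kappa> m. 1 \<le> n \<longrightarrow> martingale_tilt n \<kappa> m \<and> PE n = damped_esscher n \<kappa> m"
    using EMM_is_damped_esscher assms(10) by blast
  then obtain k m where tilt: "\<And>n. 1 \<le> n \<Longrightarrow> martingale_tilt n (k n) (m n)"
    and PE: "\<And>n. 1 \<le> n \<Longrightarrow> PE n = damped_esscher n (k n) (m n)"
    by metis
  have m: "0 < m n" "damped_mgf n (k n) = ennreal (m n)" if "1 \<le> n" for n
    using tilt[OF that] by (auto simp: martingale_tilt_def)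
  have "(\<lambda>n. damped_mgf n (k n)) \<longlonglongrightarrow> mgf P T L \<kappa>\<^sub>0"
    unfolding damped_mgf_def mgf_def
  proof (rule damped_mgf_minimum_tendsto[OF L_T S_P big_jumps_sq_nonneg])
    show "(\<integral>\<^sup>+\<omega>. ennreal (exp (k n * L T \<omega> - S \<omega> / real n)) \<partial>P)
        \<le> (\<integral>\<^sup>+\<omega>. ennreal (exp (\<kappa> * L T \<omega> - S \<omega> / real n)) \<partial>P)" if "1 \<le> n" for n \<kappa>
      using martingale_tilt_minimises[OF tilt[OF that], of \<kappa>] by (simp add: damped_mgf_def)
    show "(\<integral>\<^sup>+\<omega>. ennreal (exp (\<kappa>\<^sub>0 * L T \<omega>)) \<partial>P) \<le> (\<integral>\<^sup>+\<omega>. ennreal (exp (\<kappa> * L T \<omega>)) \<partial>P)" for \<kappa>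
      using assms(9)[of \<kappa>] by (simp add: mgf_def)
    show "\<not> (AE \<omega> in P. L T \<omega> \<le> 0)" by (rule pos_part_if_not_subordinator) fact
    show "\<not> (AE \<omega> in P. 0 \<le> L T \<omega>)" using subordinator_if_AE_nonneg assms(7) by blast
  qed
  then have "(\<lambda>n. enn2real (damped_mgf n (k n))) \<longlonglongrightarrow> c"
    unfolding c(1) using c(2) by (intro tendsto_enn2real) auto
  then have m_lim: "m \<longlonglongrightarrow> c"
  proof (rule Lim_transform_eventually)
    show "eventually (\<lambda>n. enn2real (damped_mgf n (k n)) = m n) sequentially"
      using eventually_ge_at_top[of 1] by eventually_elim (simp add: m less_imp_le)
  qed
  have ln_lim: "(\<lambda>n. - ln (m n)) \<longlonglongrightarrow> - ln c" using m_lim c(2) by (intro tendsto_intros) auto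
  have lower: "ereal (- ln c) \<le> rel_entropy (F T) Q P" if "Q \<in> M_loc_a P F T L" for Q
    by (rule entropy_lower_bound_M_loc_a[OF that c])
  have PE_M: "PE n \<in> M_loc_a P F T L" if "1 \<le> n" for n
    unfolding PE[OF that] by (rule damped_esscher_in_M_loc_a[OF tilt[OF that]])
  have lim1: "(\<lambda>n. rel_entropy (F T) (PE n) P) \<longlonglongrightarrow> ereal (- ln c)"
  proof (rule tendsto_sandwich)
    show "eventually (\<lambda>n. ereal (- ln c) \<le> rel_entropy (F T) (PE n) P) sequentially"
      using eventually_ge_at_top[of 1] by eventually_elim (intro lower PE_M)
    show "eventually (\<lambda>n. rel_entropy (F T) (PE n) P \<le> ereal (- ln (m n))) sequentially"
      using eventually_ge_at_top[of 1]
    proof eventually_elim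
      case (elim n)
      show ?case unfolding PE[OF elim] by (rule entropy_wrt_P_le[OF tilt[OF elim]])
    qed
    show "(\<lambda>n. ereal (- ln (m n))) \<longlonglongrightarrow> ereal (- ln c)" using ln_lim by simp
  qed simp
  have lim2: "(\<lambda>n. rel_entropy (F T) (PE n) (P_approx P F T L \<nu> n)) \<longlonglongrightarrow> ereal (- ln c)"
  proof (rule Lim_transform_eventually)
    have "(\<lambda>n. - (T * (\<integral>x. (1 - exp (- rho n x)) \<partial>\<nu>)) + - ln (m n)) \<longlonglongrightarrow> - (T * 0) + - ln c"
      by (intro tendsto_add[OF _ ln_lim] tendsto_minus tendsto_mult tendsto_const compensator_tendsto_0 assms(6))
    then show "(\<lambda>n. ereal (- (T * (\<integral>x. (1 - exp (- rho n x)) \<partial>\<nu>)) - ln (m n))) \<longlonglongrightarrow> ereal (- ln c)" by simp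
    show "eventually (\<lambda>n. ereal (- (T * (\<integral>x. (1 - exp (- rho n x)) \<partial>\<nu>)) - ln (m n))
        = rel_entropy (F T) (PE n) (P_approx P F T L \<nu> n)) sequentially"
      using eventually_ge_at_top[of 1]
    proof eventually_elim
      case (elim n)
      show ?case unfolding PE[OF elim] by (rule entropy_wrt_approx[OF tilt[OF elim], symmetric])
    qed
  qed
  have "(INF Q\<in>M_loc_a P F T L. rel_entropy (F T) Q P) = ereal (- ln c)"
  proof (rule antisym)
    show "(INF Q\<in>M_loc_a P F T L. rel_entropy (F T) Q P) \<le> ereal (- ln c)"
      by (rule LIMSEQ_le_const[OF lim1]) (use PE_M in \<open>auto intro!: exI[of _ 1] INF_lower\<close>)
    show "ereal (- ln c) \<le> (INF Q\<in>M_loc_a P F T L. rel_entropy (F T) Q P)"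
      by (rule INF_greatest) (rule lower)
  qed
  moreover have "enn2real (mgf P T L \<kappa>\<^sub>0) = c" using c by simp
  ultimately show ?thesis using lim1 lim2 by simp
qed

end
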